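(* Let $b=a\,\Phi\in C^1_\sharp(Y_2)^2$, where $a\in C^1_\sharp(Y_2)$ changes sign and $\Phi\in C^3_\sharp(Y_2)^2$ does not vanish. Assume there exists a positive function $\sigma\in C^3_\sharp(Y_2)$ with mean value $1$ such that $\sigma\Phi$ is divergence free in $\mathbb{R}^2$ and the mean value $\int_{Y_2}\sigma\Phi\,dy$ is incommensurable. Then the support of every invariant probability measure for the flow of $b$ is contained in $\{a=0\}$; in particular $\mathsf{C}_b=\{0_{\mathbb{R}^2}\}$.
   Context: $Y_2=\mathbb{R}^2/\mathbb{Z}^2$; $C^k_\sharp(Y_2)$ denotes $\mathbb{Z}^2$-periodic $C^k$ functions on $\mathbb{R}^2$. The flow $X$ of $b$: $\partial_tX=b(X)$, $X(0,x)=x$. A Borel probability measure $\mu$ on $Y_2$ is invariant if $\int\psi(X(t,y))\,d\mu(y)=\int\psi\,d\mu$ for all $t$ and continuous periodic $\psi$; $\mathsf{C}_b=\{\int b\,d\mu:\mu\text{ invariant probability measure}\}$. A vector $\zeta\in\mathbb{R}^2$ is incommensurable if it is not of the form $t\,k$ with $t\in\mathbb{R}$, $k\in\mathbb{Z}^2$. *)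

theory Defs
  imports "HOL-Analysis.Analysis" "HOL-Probability.Probability"
begin

text \<open>Points of R^2 are pairs of reals. The torus Y_2 = R^2/Z^2 is represented
  through Z^2-periodic objects on R^2.\<close>

definition periodic2 :: "(real \<times> real \<Rightarrow> 'b) \<Rightarrow> bool" where
  "periodic2 f \<longleftrightarrow> (\<forall>x (k1::int) (k2::int). f (x + (of_int k1, of_int k2)) = f x)"

fun Ck :: "nat \<Rightarrow> (real \<times> real \<Rightarrow> real) \<Rightarrow> bool" where
  "Ck 0 f = continuous_on UNIV f"
| "Ck (Suc k) f = (\<exists>f1 f2. (\<forall>x. (f has_derivative (\<lambda>h. fst h * f1 x + snd h * f2 x)) (at x))
                           \<and> Ck k f1 \<and> Ck k f2)"

definition Ck_per :: "nat \<Rightarrow> (real \<times> real \<Rightarrow> real) \<Rightarrow> bool" where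
  "Ck_per k f \<longleftrightarrow> Ck k f \<and> periodic2 f"

definition Ck_per_vec :: "nat \<Rightarrow> (real \<times> real \<Rightarrow> real \<times> real) \<Rightarrow> bool" where
  "Ck_per_vec k F \<longleftrightarrow> Ck_per k (\<lambda>x. fst (F x)) \<and> Ck_per k (\<lambda>x. snd (F x))"

definition divergence2 :: "(real \<times> real \<Rightarrow> real \<times> real) \<Rightarrow> real \<times> real \<Rightarrow> real" where
  "divergence2 F x = frechet_derivative (\<lambda>y. fst (F y)) (at x) (1, 0)
                   + frechet_derivative (\<lambda>y. snd (F y)) (at x) (0, 1)"

definition mean2 :: "(real \<times> real \<Rightarrow> 'b::euclidean_space) \<Rightarrow> 'b" where
  "mean2 f = integral (cbox (0, 0) (1, 1)) f"

definition incommensurable :: "real \<times> real \<Rightarrow> bool" where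
  "incommensurable \<zeta> \<longleftrightarrow> \<not> (\<exists>(t::real) (k1::int) (k2::int). \<zeta> = t *\<^sub>R (of_int k1, of_int k2))"

definition is_flow :: "(real \<times> real \<Rightarrow> real \<times> real) \<Rightarrow> (real \<Rightarrow> real \<times> real \<Rightarrow> real \<times> real) \<Rightarrow> bool" where
  "is_flow b X \<longleftrightarrow> (\<forall>x. X 0 x = x) \<and>
     (\<forall>x t. ((\<lambda>s. X s x) has_vector_derivative b (X t x)) (at t))"

text \<open>A Borel probability measure on Y_2 is represented as a Borel probability
  measure on R^2 concentrated on the fundamental cell [0,1)^2.\<close>
definition torus_prob :: "(real \<times> real) measure \<Rightarrow> bool" where
  "torus_prob \<mu> \<longleftrightarrow> prob_space \<mu> \<and> sets \<mu> = sets borel \<and>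
     emeasure \<mu> (UNIV - ({0..<1} \<times> {0..<1})) = 0"

definition invariant_measure ::
  "(real \<Rightarrow> real \<times> real \<Rightarrow> real \<times> real) \<Rightarrow> (real \<times> real) measure \<Rightarrow> bool" where
  "invariant_measure X \<mu> \<longleftrightarrow> torus_prob \<mu> \<and>
     (\<forall>t (\<psi>::real \<times> real \<Rightarrow> real). continuous_on UNIV \<psi> \<and> periodic2 \<psi> \<longrightarrow>
        (\<integral>y. \<psi> (X t y) \<partial>\<mu>) = (\<integral>y. \<psi> y \<partial>\<mu>))"

text \<open>Support of the measure on the torus, lifted to a Z^2-periodic subset of R^2:
  y belongs to it iff every neighbourhood of the class of y has positive measure.\<close>
definition torus_support :: "(real \<times> real) measure \<Rightarrow> (real \<times> real) set" where
  "torus_support \<mu> = {y. \<forall>e>0. emeasure \<mu>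
      {z. \<exists>(k1::int) (k2::int). dist z (y + (of_int k1, of_int k2)) < e} > 0}"

definition C_set :: "(real \<Rightarrow> real \<times> real \<Rightarrow> real \<times> real) \<Rightarrow> (real \<times> real \<Rightarrow> real \<times> real)
                     \<Rightarrow> (real \<times> real) set" where
  "C_set X b = {(\<integral>y. b y \<partial>\<mu>) | \<mu>. invariant_measure X \<mu>}"

end

theory Submission
  imports Defs
begin

text \<open>The field \<open>\<sigma>\<Phi>\<close> is divergence free, so it is the rotated gradient of a stream function \<open>u\<close>
  on the plane with \<open>u (x + k) = u x + \<xi> \<bullet> k\<close>, where \<open>\<xi>\<close> is the rotated mean of \<open>\<sigma>\<Phi>\<close>.
  Invariance of \<open>\<mu>\<close> says that \<open>a \<mu>\<close> is divergence free along \<open>\<Phi>\<close> in the weak sense, and so is its positive part.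
  The support \<open>S\<close> of the positive part is a closed periodic set. In the local coordinates given by \<open>u\<close>
  and a transversal one sees that \<open>S\<close> meets each level set of \<open>u\<close> in a relatively open set.
  Level sets of \<open>u\<close> are connected, since \<open>u\<close> has no critical points and an iteration of damped Newton steps
  retracts the plane onto a level set; so \<open>S\<close> is a union of level sets. As the values \<open>\<xi> \<bullet> k\<close> are dense,
  \<open>S\<close> is empty or the whole plane, and the latter is impossible because \<open>a\<close> takes negative values.
  The negative part is treated by replacing \<open>(a, \<Phi>)\<close> with \<open>(- a, - \<Phi>)\<close>.\<close>

text \<open>Trajectories of \<open>b\<close> never cross the zeros of \<open>a\<close>, and nothing
  relates \<open>\<mu>\<close> to Lebesgue measure, so ergodicity of an irrational flow cannot
  simply be quoted. What survives is a stationary equation: the integral of a (grad \<psi> . \<Phi>)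
  against \<open>\<mu>\<close> is 0 for every \<open>\<psi>\<close>. Formally the measure a \<mu> is
  carried along the orbits of \<open>\<Phi>\<close>; but it is signed, and cancellation would defeat
  any argument about supports, hence the splitting by sign. The flow of \<open>\<Phi>\<close> is
  never constructed. Since \<open>\<Phi>\<close> is tangent to the levels of \<open>u\<close>, a
  test function A(u) B(w) with a transversal coordinate \<open>w\<close> only feels B', and the
  equation compares the masses near two neighbouring points of one level line. Passing from
  neighbouring points to a whole line is exactly what connectedness provides. As \<open>u\<close> is
  not periodic, all this takes place in the plane, with balls of the torus lifted to periodic
  sets.\<close>

declare split_paired_All [simp del] split_paired_Ex [simp del]

subsection \<open>Periodic functions\<close>

text \<open>The class of test functions. The gradient is an explicit argument because the weak
  equations below integrate it against a field, so its formula is needed after products,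
  compositions and periodization.\<close>

definition C1_per :: "(real \<times> real \<Rightarrow> real) \<Rightarrow> (real \<times> real \<Rightarrow> real \<times> real) \<Rightarrow> bool" where
  "C1_per f g \<longleftrightarrow> (\<forall>x. (f has_derivative (\<lambda>h. g x \<bullet> h)) (at x)) \<and> continuous_on UNIV g
     \<and> periodic2 f \<and> periodic2 g"

lemma periodic2I: "(\<And>x (k1::int) (k2::int). f (x + (of_int k1, of_int k2)) = f x) \<Longrightarrow> periodic2 f"
  unfolding periodic2_def by (intro allI)

lemma periodic2D: "periodic2 f \<Longrightarrow> f (x + (of_int k1, of_int k2)) = f x"
  by (simp only: periodic2_def)

lemma periodic2_diffD: "periodic2 f \<Longrightarrow> f (x - (of_int k1, of_int k2)) = f x"
  using periodic2D[of f "x - (of_int k1, of_int k2)" k1 k2] by simp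

lemma unit_cell_representative:
  fixes x :: "real \<times> real"
  obtains k1 k2 :: int where "x - (of_int k1, of_int k2) \<in> {0..<1} \<times> {0..<1}"
proof -
  have "x - (of_int \<lfloor>fst x\<rfloor>, of_int \<lfloor>snd x\<rfloor>) \<in> {0..<1} \<times> {0..<1}"
    by (cases x) (auto simp: frac_def[symmetric] frac_ge_0 frac_lt_1)
  then show ?thesis by (rule that)
qed

lemma periodic2_bounded:
  fixes f :: "real \<times> real \<Rightarrow> 'b::real_normed_vector"
  assumes "continuous_on UNIV f" "periodic2 f"
  obtains B where "B > 0" "\<And>x. norm (f x) \<le> B"
proof -
  have "compact (f ` cbox (0,0) (1,1))"
    by (intro compact_continuous_image continuous_on_subset[OF assms(1)]) auto
  then obtain B where B: "B > 0" "\<And>y. y \<in> f ` cbox (0,0) (1,1) \<Longrightarrow> norm y \<le> B"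
    using bounded_pos compact_imp_bounded by metis
  have "norm (f x) \<le> B" for x
  proof -
    obtain k1 k2 :: int where k: "x - (of_int k1, of_int k2) \<in> {0..<1} \<times> {0..<1}"
      by (rule unit_cell_representative)
    then have "x - (of_int k1, of_int k2) \<in> cbox (0,0) (1,1)"
      by (auto simp: cbox_Pair_eq)
    then show ?thesis
      using B(2) periodic2_diffD[OF assms(2), of x k1 k2] by (metis imageI)
  qed
  with B(1) show ?thesis by (rule that)
qed

lemma gradient_unique:
  fixes f :: "'a::real_inner \<Rightarrow> real"
  assumes "(f has_derivative (\<lambda>h. v \<bullet> h)) (at x)" "(f has_derivative (\<lambda>h. w \<bullet> h)) (at x)"
  shows "v = w"
proof -
  have "(\<lambda>h. v \<bullet> h) = (\<lambda>h. w \<bullet> h)"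
    using assms has_derivative_unique by blast
  then show ?thesis by (metis vector_eq_rdot inner_commute)
qed

lemma periodic2_gradient:
  assumes "\<And>x. (f has_derivative (\<lambda>h. g x \<bullet> h)) (at x)"
    and per: "\<And>x (k1::int) (k2::int). f (x + (of_int k1, of_int k2)) = f x + c k1 k2"
  shows "periodic2 g"
proof (rule periodic2I)
  fix x and k1 k2 :: int
  let ?k = "(of_int k1, of_int k2) :: real \<times> real"
  have "((\<lambda>y. f (y + ?k)) has_derivative (\<lambda>h. g (x + ?k) \<bullet> h)) (at x)"
    by (rule has_derivative_compose[of "\<lambda>y. y + ?k" "\<lambda>h. h" x UNIV f, OF _ assms(1)[of "x + ?k"]])
       (auto intro!: derivative_eq_intros)
  moreover have "((\<lambda>y. f (y + ?k)) has_derivative (\<lambda>h. g x \<bullet> h)) (at x)"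
    unfolding per using assms(1)[of x] by (auto intro!: derivative_eq_intros)
  ultimately show "g (x + ?k) = g x" by (rule gradient_unique)
qed

lemma Ck_continuous: "Ck k f \<Longrightarrow> continuous_on UNIV f"
proof (induction k f rule: Ck.induct)
  case (2 k f)
  then obtain f1 f2 where "\<And>x. (f has_derivative (\<lambda>h. fst h * f1 x + snd h * f2 x)) (at x)"
    by auto
  then show ?case by (rule has_derivative_continuous_on[OF has_derivative_at_withinI])
qed simp

lemma Ck_per_gradient:
  assumes "Ck_per (Suc k) f"
  obtains g where "C1_per f g"
proof -
  obtain f1 f2 where f: "\<And>x. (f has_derivative (\<lambda>h. fst h * f1 x + snd h * f2 x)) (at x)"
    and c: "Ck k f1" "Ck k f2"
    using assms by (auto simp: Ck_per_def)
  let ?g = "\<lambda>x. (f1 x, f2 x)"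
  have d: "(f has_derivative (\<lambda>h. ?g x \<bullet> h)) (at x)" for x
    using f[of x] by (simp add: inner_prod_def mult.commute)
  have "C1_per f ?g"
    unfolding C1_per_def
  proof (intro conjI allI d)
    show "continuous_on UNIV ?g"
      by (intro continuous_on_Pair Ck_continuous[OF c(1)] Ck_continuous[OF c(2)])
    show "periodic2 f" using assms by (simp add: Ck_per_def)
    then show "periodic2 ?g"
      by (intro periodic2_gradient[of f ?g "\<lambda>_ _. 0"] d) (simp add: periodic2D)
  qed
  then show ?thesis by (rule that)
qed

lemma C1_perD:
  assumes "C1_per f g"
  shows "(f has_derivative (\<lambda>h. g x \<bullet> h)) (at x)" "continuous_on UNIV g" "periodic2 f" "periodic2 g"
  using assms unfolding C1_per_def by blast+

lemma C1_per_continuous: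
  assumes "C1_per f g"
  shows "continuous_on UNIV f"
  by (rule has_derivative_continuous_on[OF has_derivative_at_withinI]) (rule C1_perD(1)[OF assms])

lemma C1_per_mult:
  assumes "C1_per f g" "C1_per f' g'"
  shows "C1_per (\<lambda>x. f x * f' x) (\<lambda>x. f x *\<^sub>R g' x + f' x *\<^sub>R g x)"
  unfolding C1_per_def
proof (intro conjI allI)
  note f = C1_perD[OF assms(1)] and f' = C1_perD[OF assms(2)]
  show "((\<lambda>x. f x * f' x) has_derivative (\<lambda>h. (f x *\<^sub>R g' x + f' x *\<^sub>R g x) \<bullet> h)) (at x)" for x
    by (rule has_derivative_eq_rhs[OF has_derivative_mult[OF f(1) f'(1)]])
       (simp add: fun_eq_iff inner_add_left)
  show "continuous_on UNIV (\<lambda>x. f x *\<^sub>R g' x + f' x *\<^sub>R g x)"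
    by (intro continuous_on_add continuous_on_scaleR C1_per_continuous[OF assms(1)]
        C1_per_continuous[OF assms(2)] f f')
  show "periodic2 (\<lambda>x. f x * f' x)" "periodic2 (\<lambda>x. f x *\<^sub>R g' x + f' x *\<^sub>R g x)"
    using f f' by (auto intro!: periodic2I simp only: periodic2D)
qed

lemma C1_per_lipschitz:
  assumes "C1_per f g"
  obtains L where "L > 0" "\<And>x y. \<bar>f x - f y\<bar> \<le> L * norm (x - y)"
proof -
  obtain L where L: "L > 0" "\<And>x. norm (g x) \<le> L"
    using periodic2_bounded[OF C1_perD(2,4)[OF assms]] by metis
  have "onorm (\<lambda>h. g x \<bullet> h) \<le> L" for x
  proof (rule onorm_le)
    fix h
    show "norm (g x \<bullet> h) \<le> L * norm h"
      using Cauchy_Schwarz_ineq2[of "g x" h] mult_right_mono[OF L(2)[of x], of "norm h"] by simp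
  qed
  then have "\<bar>f x - f y\<bar> \<le> L * norm (x - y)" for x y
    using differentiable_bound[of UNIV f "\<lambda>x h. g x \<bullet> h" L y x] C1_perD(1)[OF assms]
    by (simp add: norm_minus_commute)
  with L(1) show ?thesis by (rule that)
qed

lemma C1_per_pair_lipschitz:
  assumes "C1_per (\<lambda>x. fst (F x)) g1" "C1_per (\<lambda>x. snd (F x)) g2"
  obtains L where "L > 0" "\<And>x y. norm (F x - F y) \<le> L * norm (x - y)"
proof -
  obtain L1 where L1: "L1 > 0" "\<And>x y. \<bar>fst (F x) - fst (F y)\<bar> \<le> L1 * norm (x - y)"
    using C1_per_lipschitz[OF assms(1)] by metis
  obtain L2 where L2: "L2 > 0" "\<And>x y. \<bar>snd (F x) - snd (F y)\<bar> \<le> L2 * norm (x - y)"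
    using C1_per_lipschitz[OF assms(2)] by metis
  have "norm (F x - F y) \<le> (L1 + L2) * norm (x - y)" for x y
    using norm_Pair_le[of "fst (F x - F y)" "snd (F x - F y)"] L1(2)[of x y] L2(2)[of x y]
    by (simp add: distrib_right flip: minus_prod_def)
  with L1(1) L2(1) show ?thesis by (intro that[of "L1 + L2"]) auto
qed

lemma C1_per_pair_continuous:
  assumes "C1_per (\<lambda>x. fst (F x)) g1" "C1_per (\<lambda>x. snd (F x)) g2"
  shows "continuous_on UNIV F"
  using continuous_on_Pair[OF C1_per_continuous[OF assms(1)] C1_per_continuous[OF assms(2)]] by simp

lemma C1_per_compose:
  assumes f: "C1_per f g" and \<eta>: "\<And>s. (\<eta> has_field_derivative \<eta>' s) (at s)" "continuous_on UNIV \<eta>'"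
  shows "C1_per (\<lambda>x. \<eta> (f x)) (\<lambda>x. \<eta>' (f x) *\<^sub>R g x)"
  unfolding C1_per_def
proof (intro conjI allI)
  note cont = C1_per_continuous[OF f] and f = C1_perD[OF f]
  show "((\<lambda>x. \<eta> (f x)) has_derivative (\<lambda>h. (\<eta>' (f x) *\<^sub>R g x) \<bullet> h)) (at x)" for x
    using has_derivative_compose[OF f(1) \<eta>(1)[unfolded has_field_derivative_def]] by simp
  show "continuous_on UNIV (\<lambda>x. \<eta>' (f x) *\<^sub>R g x)"
    by (intro continuous_on_scaleR f continuous_on_compose2[OF \<eta>(2) cont]) auto
  show "periodic2 (\<lambda>x. \<eta> (f x))" "periodic2 (\<lambda>x. \<eta>' (f x) *\<^sub>R g x)"
    using f by (auto intro!: periodic2I simp only: periodic2D)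
qed

lemma C1_per_minus: "C1_per f g \<Longrightarrow> C1_per (\<lambda>x. - f x) (\<lambda>x. - g x)"
  using C1_per_compose[of f g uminus "\<lambda>_. - 1", OF _ DERIV_minus[OF DERIV_ident]] by simp

subsection \<open>Lipschitz flows\<close>

lemma has_vector_derivative_uminus: "(uminus has_vector_derivative (- 1)) (at (s::real))"
  by (auto intro!: derivative_eq_intros)

text \<open>Gronwall's inequality for the squared distance \<open>f\<close>: from f' \<le> 2 L f the
  function f(t) exp(-2 L t) is nonincreasing. Squaring keeps the distance differentiable where the
  trajectories might meet.\<close>

lemma trajectories_dist_forward:
  assumes p: "\<And>s. (p has_vector_derivative b (p s)) (at s)"
    and q: "\<And>s. (q has_vector_derivative b (q s)) (at s)"
    and lip: "\<And>x y. norm (b x - b y) \<le> L * norm (x - y)" and "t \<ge> 0"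
  shows "norm (p t - q t :: 'a::real_inner) \<le> exp (L * t) * norm (p 0 - q 0)"
proof -
  define f where "f s = (norm (p s - q s))\<^sup>2" for s
  define f' where "f' s = 2 * ((p s - q s) \<bullet> (b (p s) - b (q s)))" for s
  have f: "(f has_field_derivative f' s) (at s)" for s
    unfolding f_def f'_def dot_square_norm[symmetric] has_field_derivative_def
    by (rule derivative_eq_intros p[unfolded has_vector_derivative_def]
          q[unfolded has_vector_derivative_def] refl)+
       (auto simp: fun_eq_iff inner_diff_left inner_diff_right algebra_simps inner_commute)
  have f'_le: "f' s \<le> 2 * L * f s" for s
  proof -
    have "(p s - q s) \<bullet> (b (p s) - b (q s)) \<le> norm (p s - q s) * norm (b (p s) - b (q s))"
      by (rule norm_cauchy_schwarz)
    also have "\<dots> \<le> norm (p s - q s) * (L * norm (p s - q s))"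
      by (intro mult_left_mono lip) auto
    finally show ?thesis by (simp add: f_def f'_def power2_eq_square mult_ac)
  qed
  have "f t * exp (- 2 * L * t) \<le> f 0 * exp (- 2 * L * 0)"
  proof (rule DERIV_nonpos_imp_nonincreasing[OF \<open>t \<ge> 0\<close>])
    fix s
    have "((\<lambda>s. f s * exp (- 2 * L * s)) has_field_derivative
        (f' s - 2 * L * f s) * exp (- 2 * L * s)) (at s)"
      by (auto intro!: derivative_eq_intros f simp: algebra_simps)
    moreover have "(f' s - 2 * L * f s) * exp (- 2 * L * s) \<le> 0"
      using f'_le[of s] by (intro mult_nonpos_nonneg) auto
    ultimately show "\<exists>y. ((\<lambda>s. f s * exp (- 2 * L * s)) has_field_derivative y) (at s) \<and> y \<le> 0"
      by blast
  qed
  moreover have "exp (- 2 * L * t) * (exp (L * t))\<^sup>2 = 1"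
    by (simp add: power2_eq_square flip: exp_add)
  ultimately have "f t \<le> f 0 * (exp (L * t))\<^sup>2"
    using mult_right_mono[of "f t * exp (- 2 * L * t)" "f 0" "(exp (L * t))\<^sup>2"]
    by (simp add: mult.assoc)
  then have "(norm (p t - q t))\<^sup>2 \<le> (exp (L * t) * norm (p 0 - q 0))\<^sup>2"
    by (simp add: f_def power_mult_distrib mult.commute)
  then show ?thesis by (rule power2_le_imp_le) simp
qed

lemma trajectories_dist:
  assumes p: "\<And>s. (p has_vector_derivative b (p s)) (at s)"
    and q: "\<And>s. (q has_vector_derivative b (q s)) (at s)"
    and lip: "\<And>x y. norm (b x - b y) \<le> L * norm (x - y)"
  shows "norm (p t - q t :: 'a::real_inner) \<le> exp (L * \<bar>t\<bar>) * norm (p 0 - q 0)"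
proof (cases "t \<ge> 0")
  case True
  then show ?thesis using trajectories_dist_forward[OF p q lip] by simp
next
  case False
  \<comment> \<open>Reversing time replaces \<open>b\<close> by its negative, which has the same
    Lipschitz constant.\<close>
  have rev: "((\<lambda>s. r (- s)) has_vector_derivative - b (r (- s))) (at s)"
    if "\<And>s. (r has_vector_derivative b (r s)) (at s)" for r s
    using has_vector_derivative_uminus[of s] vector_diff_chain_at[of uminus "-1" s r "b (r (- s))"] that
    by (simp add: o_def has_vector_derivative_minus)
  show ?thesis
    using False trajectories_dist_forward[where b="\<lambda>x. - b x" and t="-t" and L=L,
        OF rev[OF p] rev[OF q]] lip
    by (simp add: norm_minus_commute)
qed

lemma flow_dist:
  assumes flow: "is_flow b X" and lip: "\<And>x y. norm (b x - b y) \<le> L * norm (x - y)"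
  shows "norm (X t y - X t z) \<le> exp (L * \<bar>t\<bar>) * norm (y - z)"
  using trajectories_dist[of "\<lambda>s. X s y" b "\<lambda>s. X s z" L t] flow lip
  by (simp add: is_flow_def)

lemma flow_continuous:
  assumes flow: "is_flow b X" and lip: "\<And>x y. norm (b x - b y) \<le> L * norm (x - y)"
  shows "continuous_on UNIV (X t)"
proof (rule lipschitz_on_continuous_on)
  show "(exp (L * \<bar>t\<bar>))-lipschitz_on UNIV (X t)"
    by (rule lipschitz_onI) (use flow_dist[OF assms] in \<open>auto simp: dist_norm\<close>)
qed

lemma flow_speed:
  assumes flow: "is_flow b X" and B: "\<And>x. norm (b x) \<le> B"
  shows "norm (X t y - y) \<le> B * \<bar>t\<bar>"
proof -
  have "norm (X t y - X 0 y) \<le> B * norm (t - 0)"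
  proof (rule differentiable_bound[of UNIV "\<lambda>s. X s y" "\<lambda>s h. h *\<^sub>R b (X s y)"])
    show "onorm (\<lambda>h. h *\<^sub>R b (X s y)) \<le> B" for s
      by (rule onorm_le) (use mult_right_mono[OF B[of "X s y"] abs_ge_zero] in \<open>simp add: mult.commute\<close>)
  qed (use flow in \<open>auto simp: is_flow_def has_vector_derivative_def intro: has_derivative_at_withinI\<close>)
  then show ?thesis using flow by (simp add: is_flow_def)
qed

text \<open>Comparison with the constant trajectory at \<open>y\<close>. This makes the Dirac
  measure at a zero of \<open>b\<close> invariant, so that invariant measures exist at all.\<close>

lemma flow_equilibrium:
  assumes flow: "is_flow b X" and lip: "\<And>x y. norm (b x - b y) \<le> L * norm (x - y)"
    and "b y = 0"
  shows "X t y = y"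
  using trajectories_dist[of "\<lambda>s. X s y" b "\<lambda>s. y" L t] flow lip \<open>b y = 0\<close>
  by (simp add: is_flow_def)

subsection \<open>Stream functions\<close>

text \<open>The potential is obtained by integrating along the rays from the origin.\<close>
lemma closed_form_potential:
  fixes g1 g2 :: "real \<times> real \<Rightarrow> real"
  assumes d1: "\<And>x. (g1 has_derivative (\<lambda>h. D1 x \<bullet> h)) (at x)" and c1: "continuous_on UNIV D1"
    and d2: "\<And>x. (g2 has_derivative (\<lambda>h. D2 x \<bullet> h)) (at x)" and c2: "continuous_on UNIV D2"
    and closed: "\<And>x. snd (D1 x) = fst (D2 x)"
  obtains u where "\<And>x. (u has_derivative (\<lambda>h. (g1 x, g2 x) \<bullet> h)) (at x)"
proof -
  \<comment> \<open>\<open>V x\<close> plays two roles. By the product rule it is the derivative in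
    \<open>t\<close> of t times the field at t x, so its integral over [0,1] is the field at
    \<open>x\<close>. Thanks to \<open>closed\<close>, it is also the gradient in \<open>x\<close>
    of the integrand \<open>f x t\<close>, so that integral is the gradient of the
    potential.\<close>
  define V where "V x t = (g1 (t *\<^sub>R x), g2 (t *\<^sub>R x)) +
     (t * (fst x * fst (D1 (t *\<^sub>R x)) + snd x * snd (D1 (t *\<^sub>R x))),
      t * (fst x * fst (D2 (t *\<^sub>R x)) + snd x * snd (D2 (t *\<^sub>R x))))" for x :: "real \<times> real" and t :: real
  define f where "f x t = fst x * g1 (t *\<^sub>R x) + snd x * g2 (t *\<^sub>R x)" for x :: "real \<times> real" and t :: real
  have g: "continuous_on UNIV g1" "continuous_on UNIV g2"
    by (rule has_derivative_continuous_on[OF has_derivative_at_withinI[OF d1]])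
       (rule has_derivative_continuous_on[OF has_derivative_at_withinI[OF d2]])
  have df: "((\<lambda>x. f x t) has_derivative blinfun_apply (blinfun_inner_right (V x t))) (at x)" for x t
  proof -
    have s: "((\<lambda>x. t *\<^sub>R x) has_derivative (\<lambda>h. t *\<^sub>R h)) (at x)"
      by (auto intro!: derivative_eq_intros)
    show ?thesis
      unfolding f_def
      by (rule derivative_eq_intros has_derivative_compose[OF s d1] has_derivative_compose[OF s d2] refl)+
         (simp add: V_def fun_eq_iff inner_prod_def closed algebra_simps)
  qed
  have cV: "continuous_on UNIV (\<lambda>(x, t). V x t)"
    unfolding V_def case_prod_beta
    by (intro continuous_intros continuous_on_compose2[OF g(1)] continuous_on_compose2[OF g(2)]
        continuous_on_compose2[OF c1] continuous_on_compose2[OF c2]) auto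
  have V_int: "(V x has_integral (g1 x, g2 x)) {0..1}" for x
  proof -
    have s: "((\<lambda>t. t *\<^sub>R x) has_derivative (\<lambda>h. h *\<^sub>R x)) (at t within {0..1})" for t
      by (auto intro!: derivative_eq_intros)
    have "((\<lambda>t. t *\<^sub>R (g1 (t *\<^sub>R x), g2 (t *\<^sub>R x))) has_vector_derivative V x t) (at t within {0..1})" for t
      unfolding has_vector_derivative_def
      by (rule derivative_eq_intros has_derivative_compose[OF s d1] has_derivative_compose[OF s d2] refl)+
         (simp add: V_def fun_eq_iff inner_prod_def algebra_simps)
    from fundamental_theorem_of_calculus[OF zero_le_one this] show ?thesis by simp
  qed
  define u where "u x = integral {0..1} (f x)" for x
  have "(u has_derivative (\<lambda>h. (g1 x, g2 x) \<bullet> h)) (at x)" for x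
  proof -
    have c: "continuous_on (UNIV \<times> cbox 0 1) (\<lambda>(x, t). blinfun_inner_right (V x t))"
      using bounded_linear.continuous_on[OF bounded_linear_blinfun_inner_right
          continuous_on_subset[OF cV, of "UNIV \<times> cbox 0 1"]]
      by (simp add: case_prod_beta)
    have fi: "f x integrable_on cbox 0 1" for x
      unfolding f_def
      by (intro integrable_continuous continuous_intros continuous_on_compose2[OF g(1)]
          continuous_on_compose2[OF g(2)]) auto
    have "((\<lambda>x. integral (cbox 0 1) (f x)) has_derivative
        blinfun_apply (integral (cbox 0 1) (\<lambda>t. blinfun_inner_right (V x t)))) (at x)"
      using leibniz_rule[where U=UNIV and a=0 and b="1::real" and f=f
          and fx="\<lambda>x t. blinfun_inner_right (V x t)" and ?x0.0=x, OF _ fi c] df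
      by simp
    moreover have "integral (cbox 0 1) (\<lambda>t. blinfun_inner_right (V x t)) = blinfun_inner_right (g1 x, g2 x)"
      using has_integral_linear[OF V_int[of x] bounded_linear_blinfun_inner_right]
      by (auto simp: o_def intro: integral_unique)
    ultimately show ?thesis by (simp add: u_def[abs_def])
  qed
  then show ?thesis by (rule that)
qed

text \<open>The field rotated by a quarter turn is closed because \<open>F\<close> has no
  divergence. By periodicity of \<open>F\<close>, the increment of \<open>u\<close> under an integer
  shift has zero derivative, hence is a constant; these constants are additive in the shift, so the
  two unit shifts determine them.\<close>

lemma stream_function:
  assumes F1: "C1_per (\<lambda>x. fst (F x)) D1" and F2: "C1_per (\<lambda>x. snd (F x)) D2"
    and div: "\<And>x. fst (D1 x) + snd (D2 x) = 0"
  obtains u where "\<And>x. (u has_derivative (\<lambda>h. (- snd (F x), fst (F x)) \<bullet> h)) (at x)"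
    and "\<And>x (k1::int) (k2::int). u (x + (of_int k1, of_int k2))
          = u x + (of_int k2 * fst (mean2 F) - of_int k1 * snd (mean2 F))"
proof -
  have cF: "continuous_on UNIV (\<lambda>x. fst (F x))" "continuous_on UNIV (\<lambda>x. snd (F x))" "continuous_on UNIV F"
    using C1_per_continuous[OF F1] C1_per_continuous[OF F2] C1_per_pair_continuous[OF F1 F2] by auto
  obtain u where u: "\<And>x. (u has_derivative (\<lambda>h. (- snd (F x), fst (F x)) \<bullet> h)) (at x)"
  proof (rule closed_form_potential[of "\<lambda>x. - snd (F x)" "\<lambda>x. - D2 x" "\<lambda>x. fst (F x)" D1])
    show "((\<lambda>x. - snd (F x)) has_derivative (\<lambda>h. - D2 x \<bullet> h)) (at x)" for x
      using has_derivative_minus[OF C1_perD(1)[OF F2]] by simp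
    show "continuous_on UNIV (\<lambda>x. - D2 x)"
      by (intro continuous_intros C1_perD(2)[OF F2])
    show "snd (- D2 x) = fst (D1 x)" for x
      using div[of x] by simp
  qed (use C1_perD[OF F1] that in auto)
  have perF: "F (x + (of_int k1, of_int k2)) = F x" for x and k1 k2 :: int
    using periodic2D[OF C1_perD(3)[OF F1], of x k1 k2] periodic2D[OF C1_perD(3)[OF F2], of x k1 k2]
    by (simp add: prod_eq_iff)
  have "\<exists>c. \<forall>x. u (x + (of_int k1, of_int k2)) - u x = c" for k1 k2 :: int
  proof -
    let ?k = "(of_int k1, of_int k2) :: real \<times> real"
    have "((\<lambda>x. u (x + ?k) - u x) has_derivative (\<lambda>h. 0)) (at x within UNIV)" for x
    proof -
      have "((\<lambda>x. x + ?k) has_derivative (\<lambda>h. h)) (at x)"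
        by (auto intro!: derivative_eq_intros)
      from has_derivative_diff[OF has_derivative_compose[OF this u[of "x + ?k"]] u[of x]]
      show ?thesis by (simp add: perF)
    qed
    from has_derivative_zero_constant[OF convex_UNIV this] show ?thesis by auto
  qed
  then obtain c where c: "\<And>k1 k2 x. u (x + (of_int k1, of_int k2)) = u x + c k1 k2"
    by (metis diff_add_cancel add.commute)
  have c_add: "c (k1 + l1) (k2 + l2) = c k1 k2 + c l1 l2" for k1 k2 l1 l2
    using c[of 0 "k1 + l1" "k2 + l2"] c[of 0 k1 k2] c[of "(of_int k1, of_int k2)" l1 l2] by simp
  have c0: "c 0 0 = 0" using c_add[of 0 0 0 0] by simp
  \<comment> \<open>The flux through a horizontal unit segment is the same at every height
    \<open>t\<close>, so averaging over \<open>t\<close> identifies it with a component of the mean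
    over the cell; \<open>fund2\<close> does the same for vertical segments.\<close>
  have fund1: "((\<lambda>s. - snd (F (s, t))) has_integral c 1 0) {0..1}" for t
  proof -
    have s: "((\<lambda>s. (s, t)) has_derivative (\<lambda>h. (h, 0))) (at s within {0..1})" for s
      by (auto intro!: derivative_eq_intros)
    have "((\<lambda>s. u (s, t)) has_vector_derivative - snd (F (s, t))) (at s within {0..1})" for s
      unfolding has_vector_derivative_def
      by (rule has_derivative_eq_rhs[OF has_derivative_compose[OF s u]]) (simp add: inner_prod_def fun_eq_iff)
    from fundamental_theorem_of_calculus[OF zero_le_one this] c[of "(0, t)" 1 0] show ?thesis
      by simp
  qed
  have fund2: "((\<lambda>t. fst (F (s, t))) has_integral c 0 1) {0..1}" for s
  proof -
    have t: "((\<lambda>t. (s, t)) has_derivative (\<lambda>h. (0, h))) (at t within {0..1})" for t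
      by (auto intro!: derivative_eq_intros)
    have "((\<lambda>t. u (s, t)) has_vector_derivative fst (F (s, t))) (at t within {0..1})" for t
      unfolding has_vector_derivative_def
      by (rule has_derivative_eq_rhs[OF has_derivative_compose[OF t u]]) (simp add: inner_prod_def fun_eq_iff)
    from fundamental_theorem_of_calculus[OF zero_le_one this] c[of "(s, 0)" 0 1] show ?thesis
      by simp
  qed
  have int: "F integrable_on cbox (0, 0) (1, 1)"
    by (rule integrable_continuous[OF continuous_on_subset[OF cF(3)]]) simp
  have "fst (mean2 F) = integral (cbox (0, 0) (1, 1)) (\<lambda>x. fst (F x))"
    using integral_linear[OF int bounded_linear_fst] by (simp add: mean2_def o_def)
  also have "\<dots> = integral (cbox 0 1) (\<lambda>s. integral (cbox 0 1) (\<lambda>t. fst (F (s, t))))"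
    by (rule integral_prod_continuous[OF continuous_on_subset[OF cF(1)]]) simp
  also have "\<dots> = c 0 1"
    using integral_unique[OF fund2] by simp
  finally have m1: "c 0 1 = fst (mean2 F)" ..
  have "snd (mean2 F) = integral (cbox (0, 0) (1, 1)) (\<lambda>x. snd (F x))"
    using integral_linear[OF int bounded_linear_snd] by (simp add: mean2_def o_def)
  also have "\<dots> = integral (cbox 0 1) (\<lambda>s. integral (cbox 0 1) (\<lambda>t. snd (F (s, t))))"
    by (rule integral_prod_continuous[OF continuous_on_subset[OF cF(2)]]) simp
  also have "\<dots> = integral (cbox 0 1) (\<lambda>t. integral (cbox 0 1) (\<lambda>s. snd (F (s, t))))"
    using cF(2) by (intro integral_swap_continuous) (auto simp: case_prod_beta intro: continuous_on_subset)
  also have "\<dots> = - c 1 0"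
    using integral_unique[OF has_integral_neg[OF fund1]] by simp
  finally have m2: "c 1 0 = - snd (mean2 F)" by simp
  have c_Suc: "c (1 + k) 0 = c 1 0 + c k 0" "c 0 (1 + k) = c 0 1 + c 0 k" for k
    using c_add[of 1 k 0 0] c_add[of 0 0 1 k] by simp_all
  have c_nat: "c (int n) 0 = of_nat n * c 1 0" "c 0 (int n) = of_nat n * c 0 1" for n
    by (induction n) (simp_all add: c0 c_Suc distrib_right)
  have "c k 0 = of_int k * c 1 0" "c 0 k = of_int k * c 0 1" for k
    using c_nat[of "nat \<bar>k\<bar>"] c_add[of k "-k" 0 0] c_add[of 0 0 k "-k"] c0 by (cases "k \<ge> 0"; simp)+
  then have "c k1 k2 = of_int k2 * fst (mean2 F) - of_int k1 * snd (mean2 F)" for k1 k2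
    using c_add[of k1 0 0 k2] by (simp add: m1 m2)
  with u c show ?thesis by (intro that) auto
qed

text \<open>Dividing by the nonzero first component reduces this to density of the fractional parts
  of multiples of an irrational number; a rational slope p / q would make \<open>\<zeta>\<close> a
  multiple of (q, p). The linear form is the increment of the stream function under an integer
  shift.\<close>

lemma incommensurable_dense:
  assumes "incommensurable \<zeta>" "e > 0"
  obtains k1 k2 :: int where "\<bar>of_int k2 * fst \<zeta> - of_int k1 * snd \<zeta> - \<alpha>\<bar> < e"
proof -
  have not_multiple: "\<zeta> \<noteq> t *\<^sub>R (of_int k1, of_int k2)" for t and k1 k2 :: int
    using assms(1) by (auto simp: incommensurable_def)
  have z1: "fst \<zeta> \<noteq> 0"
    using not_multiple[of "snd \<zeta>" 0 1] by (auto simp: prod_eq_iff)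
  have "snd \<zeta> / fst \<zeta> \<notin> \<rat>"
  proof
    assume "snd \<zeta> / fst \<zeta> \<in> \<rat>"
    then obtain p q :: int where "q > 0" "snd \<zeta> / fst \<zeta> = of_int p / of_int q"
      by (meson Rats_cases')
    then show False
      using z1 not_multiple[of "fst \<zeta> / of_int q" q p] by (simp add: prod_eq_iff field_simps)
  qed
  then obtain h k :: int where hk:
    "\<bar>of_int k * (snd \<zeta> / fst \<zeta>) - of_int h - (- \<alpha> / fst \<zeta>)\<bar> < e / \<bar>fst \<zeta>\<bar>"
    by (rule sequence_of_fractional_parts_is_dense[where \<epsilon>="e / \<bar>fst \<zeta>\<bar>" and \<alpha>="- \<alpha> / fst \<zeta>"]) (use assms(2) z1 in auto)
  have "of_int h * fst \<zeta> - of_int k * snd \<zeta> - \<alpha>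
      = - fst \<zeta> * (of_int k * (snd \<zeta> / fst \<zeta>) - of_int h - (- \<alpha> / fst \<zeta>))"
    using z1 by (simp add: field_simps)
  then have "\<bar>of_int h * fst \<zeta> - of_int k * snd \<zeta> - \<alpha>\<bar>
      = \<bar>fst \<zeta>\<bar> * \<bar>of_int k * (snd \<zeta> / fst \<zeta>) - of_int h - (- \<alpha> / fst \<zeta>)\<bar>"
    by (simp add: abs_mult)
  also have "\<dots> < \<bar>fst \<zeta>\<bar> * (e / \<bar>fst \<zeta>\<bar>)"
    using hk z1 by (intro mult_strict_left_mono) auto
  finally show ?thesis using z1 by (intro that) simp
qed

subsection \<open>Connected level sets\<close>

text \<open>Mean value theorem along the segment, then the Lipschitz bound for the gradient at the
  intermediate point. It controls the error of one Newton step.\<close>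

lemma gradient_taylor:
  fixes u :: "'a::real_inner \<Rightarrow> real"
  assumes d: "\<And>x. (u has_derivative (\<lambda>h. g x \<bullet> h)) (at x)"
    and lip: "\<And>x y. norm (g x - g y) \<le> L * norm (x - y)"
  shows "\<bar>u (x + v) - u x - g x \<bullet> v\<bar> \<le> L * (norm v)\<^sup>2"
proof -
  have der: "((\<lambda>t. u (x + t *\<^sub>R v)) has_field_derivative g (x + t *\<^sub>R v) \<bullet> v) (at t)" for t
    unfolding has_field_derivative_def
    by (rule has_derivative_eq_rhs[OF has_derivative_compose[of "\<lambda>t. x + t *\<^sub>R v" "\<lambda>h. h *\<^sub>R v", OF _ d]])
       (auto intro!: derivative_eq_intros simp: mult.commute fun_eq_iff)
  obtain t where t: "0 < t" "t < 1" "u (x + 1 *\<^sub>R v) - u (x + 0 *\<^sub>R v) = (1 - 0) * (g (x + t *\<^sub>R v) \<bullet> v)"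
    using MVT2[of 0 1 "\<lambda>t. u (x + t *\<^sub>R v)" "\<lambda>t. g (x + t *\<^sub>R v) \<bullet> v"] der by auto
  have L: "L * norm v \<ge> 0"
    using order_trans[OF norm_ge_zero lip[of v 0]] by simp
  have "\<bar>u (x + v) - u x - g x \<bullet> v\<bar> = \<bar>(g (x + t *\<^sub>R v) - g x) \<bullet> v\<bar>"
    using t by (simp add: inner_diff_left)
  also have "\<dots> \<le> norm (g (x + t *\<^sub>R v) - g x) * norm v"
    by (rule Cauchy_Schwarz_ineq2)
  also have "\<dots> \<le> (L * norm (t *\<^sub>R v)) * norm v"
    using lip[of "x + t *\<^sub>R v" x] by (intro mult_right_mono) auto
  also have "\<dots> = t * (L * norm v * norm v)"
    using t by simp
  also have "\<dots> \<le> 1 * (L * norm v * norm v)"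
    using t L by (intro mult_right_mono) auto
  finally show ?thesis by (simp add: power2_eq_square mult.assoc)
qed

text \<open>The damped Newton step \<open>T\<close> towards \<open>{u = 0}\<close> decreases \<open>\<bar>u\<bar>\<close> by a fixed multiple of its own length, so the
  steps telescope and the iterates converge, locally uniformly, to a retraction onto \<open>{u = 0}\<close>.\<close>
lemma connected_level_set:
  fixes u :: "'a::euclidean_space \<Rightarrow> real"
  assumes d: "\<And>x. (u has_derivative (\<lambda>h. g x \<bullet> h)) (at x)"
    and lip: "\<And>x y. norm (g x - g y) \<le> L * norm (x - y)"
    and "m > 0" and g_ge: "\<And>x. m \<le> norm (g x)"
  shows "connected {x. u x = 0}"
proof -
  define K where "K = max L 1"
  have K: "K > 0" "\<And>x y. norm (g x - g y) \<le> K * norm (x - y)"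
    using order_trans[OF lip mult_right_mono[of L K]] by (auto simp: K_def)
  \<comment> \<open>Chosen so that a step with intended decrement \<kappa>, bounded by \<delta>, has
    Taylor error at most K (\<bar>\<kappa>\<bar> / m)^2 \<le> \<bar>\<kappa>\<bar> / 2.\<close>
  define \<delta> where "\<delta> = m\<^sup>2 / (2 * K)"
  have "\<delta> > 0" using K \<open>m > 0\<close> by (simp add: \<delta>_def)
  define \<kappa> where "\<kappa> s = max (- \<delta>) (min \<delta> s)" for s
  have \<kappa>_abs: "\<bar>\<kappa> s\<bar> \<le> \<delta>" "\<bar>s - \<kappa> s\<bar> = \<bar>s\<bar> - \<bar>\<kappa> s\<bar>" for s
    using \<open>\<delta> > 0\<close> by (auto simp: \<kappa>_def)
  \<comment> \<open>The shortest direction along which \<open>u\<close> grows at unit rate: moving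
    by - \<kappa> G changes \<open>u\<close> by - \<kappa> to first order.\<close>
  define G where "G x = g x /\<^sub>R (norm (g x))\<^sup>2" for x
  have g0: "g x \<noteq> 0" for x using g_ge[of x] \<open>m > 0\<close> by auto
  have G: "g x \<bullet> G x = 1" "norm (G x) \<le> 1 / m" for x
    using g0[of x] g_ge[of x] \<open>m > 0\<close>
    by (auto simp: G_def dot_square_norm power2_eq_square divide_simps)
  define T where "T x = x - \<kappa> (u x) *\<^sub>R G x" for x
  have T_step: "norm (T x - x) \<le> \<bar>\<kappa> (u x)\<bar> / m" for x
    using mult_left_mono[OF G(2)[of x], of "\<bar>\<kappa> (u x)\<bar>"] by (simp add: T_def)
  have T_dec: "\<bar>\<kappa> (u x)\<bar> \<le> 2 * (\<bar>u x\<bar> - \<bar>u (T x)\<bar>)" for x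
  proof -
    have "\<bar>u (T x) - (u x - \<kappa> (u x))\<bar> \<le> K * (norm (T x - x))\<^sup>2"
      using gradient_taylor[OF d K(2), of x "T x - x"] G(1)[of x] by (simp add: T_def)
    also have "\<dots> \<le> K * (\<bar>\<kappa> (u x)\<bar> / m)\<^sup>2"
      using K T_step by (intro mult_left_mono power_mono) auto
    also have "\<dots> = (K / m\<^sup>2) * \<bar>\<kappa> (u x)\<bar> * \<bar>\<kappa> (u x)\<bar>"
      by (simp add: power2_eq_square)
    also have "\<dots> \<le> (K / m\<^sup>2) * \<delta> * \<bar>\<kappa> (u x)\<bar>"
      using \<kappa>_abs(1)[of "u x"] K by (intro mult_right_mono mult_left_mono) auto
    also have "\<dots> = \<bar>\<kappa> (u x)\<bar> / 2"
      using K \<open>m > 0\<close> by (simp add: \<delta>_def)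
    finally have "\<bar>u (T x)\<bar> \<le> \<bar>u x - \<kappa> (u x)\<bar> + \<bar>\<kappa> (u x)\<bar> / 2" by linarith
    then show ?thesis unfolding \<kappa>_abs(2) by (simp add: field_simps)
  qed
  define S where "S n = T ^^ n" for n
  have S_Suc: "S (Suc n) x = T (S n x)" for n x by (simp add: S_def)
  have dec: "decseq (\<lambda>n. \<bar>u (S n x)\<bar>)" for x
  proof (rule decseq_SucI)
    show "\<bar>u (S (Suc n) x)\<bar> \<le> \<bar>u (S n x)\<bar>" for n
      using T_dec[of "S n x"] abs_ge_zero[of "\<kappa> (u (S n x))"] by (simp add: S_Suc)
  qed
  have far: "norm (S (n + k) x - S n x) \<le> 2 / m * (\<bar>u (S n x)\<bar> - \<bar>u (S (n + k) x)\<bar>)" for n k x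
  proof (induction k)
    case (Suc k)
    have "norm (S (n + Suc k) x - S (n + k) x) \<le> \<bar>\<kappa> (u (S (n + k) x))\<bar> / m"
      using T_step by (simp add: S_Suc)
    also have "\<dots> \<le> 2 / m * (\<bar>u (S (n + k) x)\<bar> - \<bar>u (S (n + Suc k) x)\<bar>)"
      using divide_right_mono[OF T_dec[of "S (n + k) x"], of m] \<open>m > 0\<close> by (simp add: S_Suc)
    finally show ?case
      using Suc norm_triangle_ineq[of "S (n + Suc k) x - S (n + k) x" "S (n + k) x - S n x"]
      by (simp add: right_diff_distrib)
  qed simp
  have "\<exists>l. (\<lambda>n. \<bar>u (S n x)\<bar>) \<longlonglongrightarrow> l" for x
    by (rule decseq_convergent[OF dec[of x], of 0]) auto
  then obtain l where l: "\<And>x. (\<lambda>n. \<bar>u (S n x)\<bar>) \<longlonglongrightarrow> l x"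
    by metis
  have l_le: "l x \<le> \<bar>u (S n x)\<bar>" for n x
    by (rule decseq_ge[OF dec l])
  have "Cauchy (\<lambda>n. S n x)" for x
    unfolding Cauchy_altdef2
  proof (intro allI impI)
    fix e :: real assume "e > 0"
    then have "\<forall>\<^sub>F n in sequentially. \<bar>u (S n x)\<bar> < l x + e * m / 2"
      using order_tendstoD(2)[OF l[of x]] \<open>m > 0\<close> by simp
    then obtain N where N: "\<bar>u (S N x)\<bar> < l x + e * m / 2"
      by (auto simp: eventually_sequentially)
    have "norm (S n x - S N x) < e" if "n \<ge> N" for n
    proof -
      have "norm (S n x - S N x) \<le> 2 / m * (\<bar>u (S N x)\<bar> - \<bar>u (S n x)\<bar>)"
        using far[of N "n - N" x] that by simp
      also have "\<dots> < 2 / m * (e * m / 2)"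
        using N l_le[of x n] \<open>m > 0\<close> by (intro mult_strict_left_mono) auto
      finally show ?thesis using \<open>m > 0\<close> by simp
    qed
    then show "\<exists>N. \<forall>n\<ge>N. dist (S n x) (S N x) < e"
      by (auto simp: dist_norm)
  qed
  then have "\<exists>y. (\<lambda>n. S n x) \<longlonglongrightarrow> y" for x
    using Cauchy_convergent[of "\<lambda>n. S n x"] by (simp add: convergent_def)
  then obtain r where r: "\<And>x. (\<lambda>n. S n x) \<longlonglongrightarrow> r x"
    by metis
  have cont_u: "continuous_on UNIV u"
    by (rule has_derivative_continuous_on[OF has_derivative_at_withinI[OF d]])
  have "K-lipschitz_on UNIV g"
    using K by (intro lipschitz_onI) (auto simp: dist_norm)
  then have cont_g: "continuous_on UNIV g"
    by (rule lipschitz_on_continuous_on)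
  have cont_T: "continuous_on UNIV T"
    unfolding T_def \<kappa>_def G_def using cont_u cont_g g0
    by (intro continuous_intros) auto
  have cont_S: "continuous_on UNIV (S n)" for n
  proof (induction n)
    case (Suc n)
    have "S (Suc n) = T \<circ> S n" by (simp add: S_def)
    then show ?case
      using continuous_on_compose[OF Suc continuous_on_subset[OF cont_T]] by simp
  qed (simp add: S_def)
  have u_lim: "(\<lambda>n. u (S n x)) \<longlonglongrightarrow> u (r x)" for x
    using cont_u by (intro isCont_tendsto_compose[OF _ r]) (simp add: continuous_on_eq_continuous_at)
  \<comment> \<open>The values \<bar>u\<bar> along the iteration converge, so their decrements tend
    to 0, and these dominate the truncated values. In the limit \<kappa> (u (r x)) = 0, and the
    truncation vanishes only at 0.\<close>
  have u_r: "u (r x) = 0" for x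
  proof -
    have "(\<lambda>n. \<bar>u (S n x)\<bar> - \<bar>u (S (Suc n) x)\<bar>) \<longlonglongrightarrow> l x - l x"
      by (intro tendsto_diff l LIMSEQ_Suc[OF l])
    then have "(\<lambda>n. 2 * (\<bar>u (S n x)\<bar> - \<bar>u (S (Suc n) x)\<bar>)) \<longlonglongrightarrow> 2 * 0"
      by (intro tendsto_mult tendsto_const) simp
    then have "(\<lambda>n. 2 * (\<bar>u (S n x)\<bar> - \<bar>u (S (Suc n) x)\<bar>)) \<longlonglongrightarrow> 0"
      by simp
    then have "(\<lambda>n. \<kappa> (u (S n x))) \<longlonglongrightarrow> 0"
    proof (rule Lim_null_comparison[rotated])
      show "\<forall>\<^sub>F n in sequentially. norm (\<kappa> (u (S n x))) \<le> 2 * (\<bar>u (S n x)\<bar> - \<bar>u (S (Suc n) x)\<bar>)"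
        using T_dec by (simp add: S_Suc)
    qed
    moreover have "(\<lambda>n. \<kappa> (u (S n x))) \<longlonglongrightarrow> \<kappa> (u (r x))"
      unfolding \<kappa>_def by (intro tendsto_intros u_lim)
    ultimately have "\<kappa> (u (r x)) = 0" using LIMSEQ_unique by blast
    then show ?thesis using \<open>\<delta> > 0\<close> by (auto simp: \<kappa>_def max_def min_def split: if_splits)
  qed
  \<comment> \<open>The bound depends continuously on \<open>x\<close>, so once it is small at one
    point it is small nearby for the same \<open>n\<close>; this gives continuity of the limit
    \<open>r\<close>.\<close>
  have near: "norm (r x - S n x) \<le> 2 / m * \<bar>u (S n x)\<bar>" for x n
  proof (rule Lim_bounded)
    show "(\<lambda>N. norm (S N x - S n x)) \<longlonglongrightarrow> norm (r x - S n x)"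
      by (intro tendsto_intros r)
    show "\<forall>N\<ge>n. norm (S N x - S n x) \<le> 2 / m * \<bar>u (S n x)\<bar>"
    proof (intro allI impI)
      fix N assume "N \<ge> n"
      then have "norm (S N x - S n x) \<le> 2 / m * (\<bar>u (S n x)\<bar> - \<bar>u (S N x)\<bar>)"
        using far[of n "N - n" x] by simp
      also have "\<dots> \<le> 2 / m * \<bar>u (S n x)\<bar>"
        using \<open>m > 0\<close> by (intro mult_left_mono) auto
      finally show "norm (S N x - S n x) \<le> 2 / m * \<bar>u (S n x)\<bar>" .
    qed
  qed
  have "continuous_on UNIV r"
    unfolding continuous_on_iff
  proof (intro ballI allI impI)
    fix x and e :: real assume "e > 0"
    \<comment> \<open>The three error terms will add up to \<epsilon> (1 + 4 / m); the denominator
      is a convenient strict upper bound for that factor.\<close>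
    define \<epsilon> where "\<epsilon> = e / (2 * (1 + 3 / m))"
    have "\<epsilon> > 0" using \<open>e > 0\<close> \<open>m > 0\<close> by (auto simp: \<epsilon>_def intro!: divide_pos_pos add_pos_pos)
    have "(\<lambda>n. \<bar>u (S n x)\<bar>) \<longlonglongrightarrow> 0"
      using tendsto_rabs[OF u_lim[of x]] u_r by simp
    then have "\<forall>\<^sub>F n in sequentially. \<bar>u (S n x)\<bar> < \<epsilon>"
      using order_tendstoD(2) \<open>\<epsilon> > 0\<close> by blast
    then obtain n where n: "\<bar>u (S n x)\<bar> < \<epsilon>"
      by (auto simp: eventually_sequentially)
    have "continuous_on UNIV (\<lambda>y. \<bar>u (S n y)\<bar>)"
      by (intro continuous_intros continuous_on_compose2[OF cont_u cont_S]) auto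
    then have "((\<lambda>y. \<bar>u (S n y)\<bar>) \<longlongrightarrow> \<bar>u (S n x)\<bar>) (at x)"
      by (simp add: continuous_on_eq_continuous_at isCont_def)
    then have "\<forall>\<^sub>F y in at x. \<bar>u (S n y)\<bar> < \<epsilon>"
      using n by (rule order_tendstoD(2))
    moreover have "\<forall>\<^sub>F y in at x. dist (S n y) (S n x) < \<epsilon>"
      using cont_S[of n] \<open>\<epsilon> > 0\<close>
      by (intro tendstoD[of "S n" "S n x"]) (auto simp: continuous_on_eq_continuous_at isCont_def)
    ultimately have "\<forall>\<^sub>F y in at x. \<bar>u (S n y)\<bar> < \<epsilon> \<and> dist (S n y) (S n x) < \<epsilon>"
      by (rule eventually_conj)
    then obtain \<eta> where \<eta>: "\<eta> > 0"
      "\<And>y. dist y x < \<eta> \<Longrightarrow> y \<noteq> x \<Longrightarrow> \<bar>u (S n y)\<bar> < \<epsilon> \<and> dist (S n y) (S n x) < \<epsilon>"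
      by (auto simp: eventually_at)
    have "dist (r y) (r x) < e" if y: "dist y x < \<eta>" for y
    proof (cases "y = x")
      case False
      have "dist (r y) (r x) \<le> norm (r y - S n y) + dist (S n y) (S n x) + norm (r x - S n x)"
        using dist_triangle[of "r y" "r x" "S n y"] dist_triangle[of "S n y" "r x" "S n x"]
        by (simp add: dist_norm norm_minus_commute)
      also have "\<dots> \<le> 2 / m * \<epsilon> + \<epsilon> + 2 / m * \<epsilon>"
        using \<eta>(2)[OF y False] n \<open>m > 0\<close>
        by (intro add_mono order_trans[OF near] mult_left_mono) auto
      also have "\<dots> = \<epsilon> * (1 + 4 / m)" by (simp add: algebra_simps)
      also have "\<dots> < \<epsilon> * (2 * (1 + 3 / m))"
      proof -
        have "1 + 4 * i < 2 * (1 + 3 * i)" if "i > 0" for i :: real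
          using that by simp
        from this[of "1 / m"] show ?thesis
          using \<open>\<epsilon> > 0\<close> \<open>m > 0\<close> by (intro mult_strict_left_mono) auto
      qed
      also have "\<dots> = e"
      proof -
        have "2 * (1 + 3 / m) \<noteq> 0" using \<open>m > 0\<close> by (simp add: add_pos_pos less_imp_neq[THEN not_sym])
        then show ?thesis unfolding \<epsilon>_def by (metis nonzero_eq_divide_eq)
      qed
      finally show ?thesis .
    qed (use \<open>e > 0\<close> in simp)
    then show "\<exists>\<eta>>0. \<forall>y\<in>UNIV. dist y x < \<eta> \<longrightarrow> dist (r y) (r x) < e"
      using \<eta>(1) by blast
  qed
  moreover have "range r = {x. u x = 0}"
  proof -
    \<comment> \<open>Zeros of \<open>u\<close> are fixed by \<open>T\<close>, so \<open>r\<close>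
      is a retraction and its range is the whole level set, a continuous image of the space.\<close>
    have "r x = x" if "u x = 0" for x
    proof -
      have "S n x = x" for n
        by (induction n) (use that \<open>\<delta> > 0\<close> in \<open>auto simp: S_def T_def \<kappa>_def\<close>)
      then show ?thesis using LIMSEQ_unique[OF r[of x]] by simp
    qed
    then show ?thesis using u_r by (metis (mono_tags, lifting) rangeI mem_Collect_eq subset_antisym subsetI image_subsetI)
  qed
  ultimately show ?thesis
    using connected_continuous_image[of UNIV r] connected_UNIV by simp
qed

subsection \<open>Invariant measures and the divergence\<close>

lemma bounded_convergence:
  fixes s :: "nat \<Rightarrow> 'a::topological_space \<Rightarrow> real"
  assumes "prob_space \<mu>" "sets \<mu> = sets borel"
    and cont: "\<And>n. continuous_on UNIV (s n)" and bd: "\<And>n x. \<bar>s n x\<bar> \<le> B"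
    and lim: "\<And>x. (\<lambda>n. s n x) \<longlonglongrightarrow> f x"
  shows "(\<lambda>n. \<integral>x. s n x \<partial>\<mu>) \<longlonglongrightarrow> (\<integral>x. f x \<partial>\<mu>)"
proof -
  interpret prob_space \<mu> by fact
  have s: "s n \<in> borel_measurable \<mu>" for n
    using borel_measurable_continuous_onI[OF cont] measurable_cong_sets[OF assms(2) refl] by blast
  have "f \<in> borel_measurable \<mu>"
    by (rule borel_measurable_LIMSEQ_real[OF lim s])
  then show ?thesis
    by (rule integral_dominated_convergence[where w="\<lambda>_. B"]) (use s lim bd in auto)
qed

lemma integrable_continuous_bounded:
  fixes f :: "'a::topological_space \<Rightarrow> real"
  assumes "prob_space \<mu>" "sets \<mu> = sets borel" "continuous_on UNIV f" "\<And>x. \<bar>f x\<bar> \<le> B"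
  shows "integrable \<mu> f"
proof -
  interpret prob_space \<mu> by fact
  have "f \<in> borel_measurable \<mu>"
    using borel_measurable_continuous_onI[OF assms(3)] measurable_cong_sets[OF assms(2) refl] by blast
  then show ?thesis using assms(4) by (intro integrable_const_bound[where B=B]) auto
qed

lemma invariant_measureD:
  assumes "invariant_measure X \<mu>"
  shows "prob_space \<mu>" "sets \<mu> = sets borel" "emeasure \<mu> (UNIV - ({0..<1} \<times> {0..<1})) = 0"
    and "continuous_on UNIV (\<psi> :: real \<times> real \<Rightarrow> real) \<Longrightarrow> periodic2 \<psi> \<Longrightarrow>
      (\<integral>y. \<psi> (X t y) \<partial>\<mu>) = (\<integral>y. \<psi> y \<partial>\<mu>)"
  using assms by (auto simp: invariant_measure_def torus_prob_def)

text \<open>Differentiation of the invariance identity at time 0. The difference quotients are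
  dominated by the Lipschitz constant of \<open>\<psi>\<close> times the maximal speed, so the limit
  passes under the integral.\<close>

lemma invariant_measure_divergence:
  assumes flow: "is_flow b X" and lip: "\<And>x y. norm (b x - b y) \<le> L * norm (x - y)"
    and b: "continuous_on UNIV b" "periodic2 b"
    and inv: "invariant_measure X \<mu>" and \<psi>: "C1_per \<psi> g"
  shows "(\<integral>y. g y \<bullet> b y \<partial>\<mu>) = 0"
proof -
  note \<mu> = invariant_measureD[OF inv]
  note cont_\<psi> = C1_per_continuous[OF \<psi>]
  obtain M where M: "M > 0" "\<And>x. norm (\<psi> x) \<le> M"
    using periodic2_bounded[OF cont_\<psi> C1_perD(3)[OF \<psi>]] by blast
  obtain B where B: "B > 0" "\<And>x. norm (b x) \<le> B"
    using periodic2_bounded[OF b] by blast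
  obtain K where K: "K > 0" "\<And>x y. \<bar>\<psi> x - \<psi> y\<bar> \<le> K * norm (x - y)"
    using C1_per_lipschitz[OF \<psi>] by blast
  define t where "t = (\<lambda>n. inverse (real (Suc n)))"
  have t: "t n > 0" for n by (simp add: t_def)
  define s where "s n y = (\<psi> (X (t n) y) - \<psi> y) / t n" for n y
  have cont_X: "continuous_on UNIV (\<lambda>y. \<psi> (X (t n) y))" for n
    by (rule continuous_on_compose2[OF cont_\<psi> flow_continuous[OF flow lip]]) auto
  have "(\<lambda>n. \<integral>y. s n y \<partial>\<mu>) \<longlonglongrightarrow> (\<integral>y. g y \<bullet> b y \<partial>\<mu>)"
  proof (rule bounded_convergence[OF \<mu>(1,2)])
    show "continuous_on UNIV (s n)" for n
      unfolding s_def using t[of n] by (intro continuous_intros cont_X cont_\<psi>) auto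
    show "\<bar>s n y\<bar> \<le> K * B" for n y
    proof -
      have "\<bar>\<psi> (X (t n) y) - \<psi> y\<bar> \<le> K * (B * \<bar>t n\<bar>)"
        using K flow_speed[OF flow B(2)] by (intro order_trans[OF K(2)] mult_left_mono) auto
      then show ?thesis using t[of n] by (simp add: s_def pos_divide_le_eq mult.assoc)
    qed
    show "(\<lambda>n. s n y) \<longlonglongrightarrow> g y \<bullet> b y" for y
    proof -
      have X0: "X 0 y = y" using flow by (simp add: is_flow_def)
      have X': "((\<lambda>s. X s y) has_derivative (\<lambda>h. h *\<^sub>R b (X 0 y))) (at 0)"
        using flow unfolding is_flow_def has_vector_derivative_def by blast
      have "((\<lambda>s. \<psi> (X s y)) has_derivative (\<lambda>h. g (X 0 y) \<bullet> (h *\<^sub>R b (X 0 y)))) (at 0)"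
        by (rule has_derivative_compose[OF X' C1_perD(1)[OF \<psi>]])
      then have "((\<lambda>s. \<psi> (X s y)) has_field_derivative g y \<bullet> b y) (at 0)"
        by (simp add: has_field_derivative_def X0 mult_commute_abs)
      then have "(\<lambda>h. (\<psi> (X h y) - \<psi> y) / h) \<midarrow>0\<rightarrow> g y \<bullet> b y"
        by (simp add: DERIV_def X0)
      moreover have "filterlim t (at 0) sequentially"
        using LIMSEQ_inverse_real_of_nat by (intro filterlim_atI) (auto simp: t_def)
      ultimately show ?thesis
        unfolding s_def by (rule filterlim_compose)
    qed
  qed
  moreover have "(\<integral>y. s n y \<partial>\<mu>) = 0" for n
  proof -
    have "(\<integral>y. \<psi> (X (t n) y) - \<psi> y \<partial>\<mu>) = 0"
      using \<mu>(4)[OF cont_\<psi> C1_perD(3)[OF \<psi>]] M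
        integrable_continuous_bounded[OF \<mu>(1,2) cont_X[of n], of M]
        integrable_continuous_bounded[OF \<mu>(1,2) cont_\<psi>, of M] by simp
    then show ?thesis by (simp add: s_def)
  qed
  ultimately show ?thesis using LIMSEQ_unique[OF _ tendsto_const] by simp
qed

text \<open>Squaring smooths the corner of the positive part; every cut-off below is assembled from
  this C^1 function.\<close>

lemma pos_part_square_deriv:
  "((\<lambda>s::real. (max 0 s)\<^sup>2) has_field_derivative 2 * max 0 s) (at s)"
proof -
  consider "s > 0" | "s < 0" | "s = 0" by linarith
  then show ?thesis
  proof cases
    case 1
    have "((\<lambda>s::real. s\<^sup>2) has_field_derivative 2 * max 0 s) (at s)"
      using 1 by (auto intro!: derivative_eq_intros)
    then show ?thesis
      by (rule has_field_derivative_transform_within_open[of _ _ _ "{0<..}"]) (use 1 in auto)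
  next
    case 2
    have "((\<lambda>s::real. 0) has_field_derivative 2 * max 0 s) (at s)"
      using 2 by (auto intro!: derivative_eq_intros)
    then show ?thesis
      by (rule has_field_derivative_transform_within_open[of _ _ _ "{..<0}"]) (use 2 in auto)
  next
    case 3
    have "((\<lambda>h::real. (max 0 h)\<^sup>2 / h) \<longlongrightarrow> 0) (at 0)"
    proof (rule Lim_null_comparison)
      show "\<forall>\<^sub>F h in at 0. norm ((max 0 h)\<^sup>2 / h) \<le> \<bar>h :: real\<bar>"
        by (rule always_eventually) (auto simp: max_def power2_eq_square)
      show "((\<lambda>h::real. \<bar>h\<bar>) \<longlongrightarrow> 0) (at 0)"
        by (intro tendsto_eq_intros refl) auto
    qed
    then show ?thesis using 3 by (simp add: DERIV_def)
  qed
qed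

text \<open>The test functions \<open>\<psi> \<cdot> n a\<^sub>+\<^sup>2 / (1 + n a\<^sub>+\<^sup>2)\<close> approximate \<open>\<psi>\<close> restricted to \<open>{a > 0}\<close>; the term
  containing the derivative of the cut-off stays bounded because of the factor \<open>a\<close> in \<open>b = a \<Phi>\<close>.\<close>
lemma divergence_pos_part:
  assumes \<mu>: "prob_space \<mu>" "sets \<mu> = sets borel"
    and a: "C1_per a a'" and \<Phi>: "continuous_on UNIV \<Phi>" "periodic2 \<Phi>"
    and div: "\<And>\<psi> g. C1_per \<psi> g \<Longrightarrow> (\<integral>y. g y \<bullet> (a y *\<^sub>R \<Phi> y) \<partial>\<mu>) = 0"
    and \<psi>: "C1_per \<psi> g"
  shows "(\<integral>y. max 0 (a y) * (g y \<bullet> \<Phi> y) \<partial>\<mu>) = 0"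
proof -
  define \<eta> where "\<eta> n s = real n * (max 0 s)\<^sup>2 / (1 + real n * (max 0 s)\<^sup>2)" for n s
  define \<eta>' where "\<eta>' n s = 2 * real n * max 0 s / (1 + real n * (max 0 s)\<^sup>2)\<^sup>2" for n s
  have pos: "1 + real n * (max 0 s)\<^sup>2 > 0" for n s
    by (rule add_pos_nonneg) auto
  have \<eta>_deriv: "(\<eta> n has_field_derivative \<eta>' n s) (at s)" for n s
    unfolding \<eta>_def \<eta>'_def
    by (rule derivative_eq_intros pos_part_square_deriv refl)+
       (use pos[of n s] in \<open>auto simp: field_simps power2_eq_square\<close>)
  have \<eta>'_cont: "continuous_on UNIV (\<eta>' n)" for n
    unfolding \<eta>'_def using pos by (intro continuous_intros) (metis less_irrefl power_not_zero)
  have \<eta>_le: "\<bar>\<eta> n s\<bar> \<le> 1" for n s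
    using pos[of n s] by (simp add: \<eta>_def)
  \<comment> \<open>The right-hand side is 2 \<eta> (1 - \<eta>). Hence it is bounded by 2 uniformly
    in \<open>n\<close>, and it tends to 0 because \<eta> tends to 0 or 1 at every point. This
    disposes of the cut-off derivative.\<close>
  have \<eta>'_eq: "\<eta>' n s * s = 2 * \<eta> n s * (1 / (1 + real n * (max 0 s)\<^sup>2))" for n s
    by (auto simp: \<eta>'_def \<eta>_def max_def power2_eq_square)
  have \<eta>'_le: "\<bar>\<eta>' n s * s\<bar> \<le> 2" for n s
  proof -
    have "\<bar>1 / (1 + real n * (max 0 s)\<^sup>2)\<bar> \<le> 1" using pos[of n s] by simp
    from mult_mono[OF \<eta>_le[of n s] this] show ?thesis unfolding \<eta>'_eq abs_mult by simp
  qed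
  have lim0: "(\<lambda>n. 1 / (1 + real n * (max 0 s)\<^sup>2)) \<longlonglongrightarrow> (if s > 0 then 0 else 1)" for s
  proof (cases "s > 0")
    case True
    then have "filterlim (\<lambda>n. 1 + real n * s\<^sup>2) at_top sequentially"
      by (intro filterlim_tendsto_add_at_top[OF tendsto_const]
          filterlim_at_top_mult_tendsto_pos[OF tendsto_const] filterlim_real_sequentially) auto
    then show ?thesis
      using True by (simp add: tendsto_divide_0[OF tendsto_const] filterlim_at_top_imp_at_infinity)
  qed simp
  have \<eta>_lim: "(\<lambda>n. \<eta> n s) \<longlonglongrightarrow> (if s > 0 then 1 else 0)" for s
  proof -
    have "\<eta> n s = 1 - 1 / (1 + real n * (max 0 s)\<^sup>2)" for n
      using pos[of n s] by (simp add: \<eta>_def field_simps)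
    then show ?thesis using tendsto_diff[OF tendsto_const[of 1] lim0[of s]] by (simp split: if_splits)
  qed
  have \<eta>'_lim: "(\<lambda>n. \<eta>' n s * s) \<longlonglongrightarrow> 0" for s
    unfolding \<eta>'_eq
    using tendsto_mult[OF tendsto_mult[OF tendsto_const[of 2] \<eta>_lim[of s]] lim0[of s]]
    by (simp split: if_splits)
  note a_p = C1_perD[OF a] and \<psi>_p = C1_perD[OF \<psi>]
  obtain P where P: "P > 0" "\<And>x. norm (\<Phi> x) \<le> P" using periodic2_bounded[OF \<Phi>] by blast
  obtain Q where Q: "Q > 0" "\<And>x. norm (\<psi> x) \<le> Q"
    using periodic2_bounded[OF C1_per_continuous[OF \<psi>] \<psi>_p(3)] by blast
  obtain R where R: "R > 0" "\<And>x. norm (g x) \<le> R" using periodic2_bounded[OF \<psi>_p(2,4)] by blast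
  obtain A where A: "A > 0" "\<And>x. norm (a x) \<le> A"
    using periodic2_bounded[OF C1_per_continuous[OF a] a_p(3)] by blast
  obtain D where D: "D > 0" "\<And>x. norm (a' x) \<le> D" using periodic2_bounded[OF a_p(2,4)] by blast
  define G where "G n y = \<psi> y *\<^sub>R (\<eta>' n (a y) *\<^sub>R a' y) + \<eta> n (a y) *\<^sub>R g y" for n y
  have G: "C1_per (\<lambda>y. \<psi> y * \<eta> n (a y)) (G n)" for n
    unfolding G_def by (rule C1_per_mult[OF \<psi> C1_per_compose[OF a \<eta>_deriv \<eta>'_cont]])
  have G_eq: "G n y \<bullet> (a y *\<^sub>R \<Phi> y) = \<psi> y * (\<eta>' n (a y) * a y) * (a' y \<bullet> \<Phi> y)
      + \<eta> n (a y) * (a y * (g y \<bullet> \<Phi> y))" for n y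
    by (simp add: G_def inner_add_left algebra_simps)
  have "(\<lambda>n. \<integral>y. G n y \<bullet> (a y *\<^sub>R \<Phi> y) \<partial>\<mu>) \<longlonglongrightarrow> (\<integral>y. max 0 (a y) * (g y \<bullet> \<Phi> y) \<partial>\<mu>)"
  proof (rule bounded_convergence[OF \<mu>])
    show "continuous_on UNIV (\<lambda>y. G n y \<bullet> (a y *\<^sub>R \<Phi> y))" for n
      by (intro continuous_on_inner continuous_on_scaleR C1_perD(2)[OF G] C1_per_continuous[OF a] \<Phi>)
    show "\<bar>G n y \<bullet> (a y *\<^sub>R \<Phi> y)\<bar> \<le> Q * 2 * (D * P) + 1 * (A * (R * P))" for n y
    proof -
      have i: "\<bar>a' y \<bullet> \<Phi> y\<bar> \<le> D * P" "\<bar>g y \<bullet> \<Phi> y\<bar> \<le> R * P"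
        using D(1) D(2)[of y] R(1) R(2)[of y] P(2)[of y]
        by (auto intro!: order_trans[OF Cauchy_Schwarz_ineq2] mult_mono)
      show ?thesis
        unfolding G_eq
        by (intro order_trans[OF abs_triangle_ineq] add_mono; unfold abs_mult; intro mult_mono)
           (use Q(1) Q(2)[of y] A(1) A(2)[of y] D(1) R(1) P(1) i \<eta>_le[of n "a y"] \<eta>'_le[of n "a y"] in \<open>auto simp flip: abs_mult\<close>)
    qed
    show "(\<lambda>n. G n y \<bullet> (a y *\<^sub>R \<Phi> y)) \<longlonglongrightarrow> max 0 (a y) * (g y \<bullet> \<Phi> y)" for y
    proof -
      have "(\<lambda>n. G n y \<bullet> (a y *\<^sub>R \<Phi> y)) \<longlonglongrightarrow> \<psi> y * 0 * (a' y \<bullet> \<Phi> y)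
          + (if a y > 0 then 1 else 0) * (a y * (g y \<bullet> \<Phi> y))"
        unfolding G_eq by (intro tendsto_intros \<eta>_lim \<eta>'_lim)
      also have "\<psi> y * 0 * (a' y \<bullet> \<Phi> y) + (if a y > 0 then 1 else 0) * (a y * (g y \<bullet> \<Phi> y))
          = max 0 (a y) * (g y \<bullet> \<Phi> y)"
        by simp
      finally show ?thesis .
    qed
  qed
  moreover have "(\<integral>y. G n y \<bullet> (a y *\<^sub>R \<Phi> y) \<partial>\<mu>) = 0" for n
    by (rule div[OF G])
  ultimately show ?thesis using LIMSEQ_unique[OF _ tendsto_const] by simp
qed

subsection \<open>Null sets along level lines\<close>

text \<open>The support has radius 1/4, less than half a period, so its integer translates are
  disjoint and their sum can be evaluated by moving each point to the representative nearest to
  \<open>x\<close> in each coordinate. No two translates interact, hence the gradient of the sum is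
  locally that of a single copy.\<close>

lemma periodization:
  fixes x :: "real \<times> real" and f :: "real \<times> real \<Rightarrow> real"
  assumes f: "\<And>y. (f has_derivative (\<lambda>h. g y \<bullet> h)) (at y)" and g: "continuous_on UNIV g"
    and zero: "\<And>y. dist y x > 1/4 \<Longrightarrow> f y = 0 \<and> g y = 0"
  obtains F G where "C1_per F G"
    and "\<And>y (k1::int) (k2::int). dist y x < 1/4 \<Longrightarrow> G (y + (of_int k1, of_int k2)) = g y"
    and "\<And>y. \<exists>(k1::int) (k2::int). G y = g (y - (of_int k1, of_int k2))"
proof -
  define K1 K2 where "K1 y = \<lfloor>fst y - fst x + 1/2\<rfloor>" and "K2 y = \<lfloor>snd y - snd x + 1/2\<rfloor>"
    for y :: "real \<times> real"
  \<comment> \<open>The representative of \<open>y\<close> in the half-open unit square centred at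
    \<open>x\<close>. It jumps only on the boundary of such squares, where \<open>f\<close>
    vanishes.\<close>
  define \<rho> where "\<rho> y = y - (of_int (K1 y), of_int (K2 y))" for y :: "real \<times> real"
  have K_add: "K1 (y + (of_int k1, of_int k2)) = K1 y + k1" "K2 (y + (of_int k1, of_int k2)) = K2 y + k2"
    for y k1 k2
    using floor_add_int[of "fst y - fst x + 1/2" k1] floor_add_int[of "snd y - snd x + 1/2" k2]
    by (simp_all add: K1_def K2_def algebra_simps)
  have \<rho>_per: "\<rho> (y + (of_int k1, of_int k2)) = \<rho> y" for y k1 k2
    by (simp add: \<rho>_def K_add prod_eq_iff)
  have fst_snd_far: "dist y x > 1/4" if "\<bar>fst y - fst x\<bar> > 1/4 \<or> \<bar>snd y - snd x\<bar> > 1/4" for y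
    using that dist_fst_le[of y x] dist_snd_le[of y x] by (auto simp: dist_real_def)
  \<comment> \<open>If rounding differs at points less than 1/8 apart, a half-integer separates
    them, so both remainders have modulus at least 3/8. Thus on a ball of radius 1/8 either the
    translation used is constant or both candidate points lie where \<open>f\<close> and
    \<open>g\<close> are zero.\<close>
  have floor_near: "\<bar>s - of_int \<lfloor>s + 1/2\<rfloor>\<bar> > 1/4 \<and> \<bar>s - of_int \<lfloor>t + 1/2\<rfloor>\<bar> > 1/4"
    if "\<bar>s - t\<bar> < 1/8" "\<lfloor>s + 1/2\<rfloor> \<noteq> \<lfloor>t + 1/2\<rfloor>" for s t :: real
  proof -
    have "of_int \<lfloor>s + 1/2\<rfloor> \<le> s + 1/2" "s + 1/2 < of_int \<lfloor>s + 1/2\<rfloor> + 1"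
      "of_int \<lfloor>t + 1/2\<rfloor> \<le> t + 1/2" "t + 1/2 < of_int \<lfloor>t + 1/2\<rfloor> + 1" by linarith+
    moreover have "\<lfloor>s + 1/2\<rfloor> \<ge> \<lfloor>t + 1/2\<rfloor> + 1 \<or> \<lfloor>s + 1/2\<rfloor> + 1 \<le> \<lfloor>t + 1/2\<rfloor>"
      using that(2) by linarith
    then have "of_int \<lfloor>s + 1/2\<rfloor> \<ge> of_int \<lfloor>t + 1/2\<rfloor> + (1::real) \<or> of_int \<lfloor>s + 1/2\<rfloor> + (1::real) \<le> of_int \<lfloor>t + 1/2\<rfloor>"
      by (metis of_int_1 of_int_add of_int_le_iff)
    ultimately show ?thesis using that(1) by linarith
  qed
  have same: "\<rho> y' = y' - (of_int (K1 y), of_int (K2 y)) \<or>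
      (dist (\<rho> y') x > 1/4 \<and> dist (y' - (of_int (K1 y), of_int (K2 y))) x > 1/4)"
    if "dist y' y < 1/8" for y y'
  proof -
    have d: "\<bar>(fst y' - fst x) - (fst y - fst x)\<bar> < 1/8" "\<bar>(snd y' - snd x) - (snd y - snd x)\<bar> < 1/8"
      using that dist_fst_le[of y' y] dist_snd_le[of y' y] by (auto simp: dist_real_def)
    show ?thesis
    proof (cases "K1 y' = K1 y \<and> K2 y' = K2 y")
      case True then show ?thesis by (simp add: \<rho>_def)
    next
      case False
      then consider "K1 y' \<noteq> K1 y" | "K2 y' \<noteq> K2 y" by blast
      then show ?thesis
      proof cases
        case 1
        then show ?thesis
          using floor_near[OF d(1)]
          by (intro disjI2 conjI fst_snd_far disjI1) (auto simp: \<rho>_def K1_def algebra_simps)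
      next
        case 2
        then show ?thesis
          using floor_near[OF d(2)]
          by (intro disjI2 conjI fst_snd_far) (auto simp: \<rho>_def K2_def algebra_simps)
      qed
    qed
  qed
  have local: "f (\<rho> y') = f (y' - (of_int (K1 y), of_int (K2 y)))"
      "g (\<rho> y') = g (y' - (of_int (K1 y), of_int (K2 y)))" if "y' \<in> ball y (1/8)" for y y'
    using same[of y' y] zero[of "\<rho> y'"] zero[of "y' - (of_int (K1 y), of_int (K2 y))"] that
    by (auto simp: dist_commute)
  have shift: "((\<lambda>y'. y' - k) has_derivative (\<lambda>h. h)) (at y)" for y k :: "real \<times> real"
    by (auto intro!: derivative_eq_intros)
  have "C1_per (\<lambda>y. f (\<rho> y)) (\<lambda>y. g (\<rho> y))"
    unfolding C1_per_def
  proof (intro conjI allI)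
    fix y
    have "((\<lambda>y'. f (y' - (of_int (K1 y), of_int (K2 y)))) has_derivative (\<lambda>h. g (\<rho> y) \<bullet> h)) (at y)"
      unfolding \<rho>_def by (rule has_derivative_compose[OF shift f])
    then show "((\<lambda>y. f (\<rho> y)) has_derivative (\<lambda>h. g (\<rho> y) \<bullet> h)) (at y)"
      by (rule has_derivative_transform_within_open[OF _ open_ball[of y "1/8"]]) (auto simp: local)
  next
    have "isCont (\<lambda>y. g (\<rho> y)) y" for y
    proof -
      have "\<forall>\<^sub>F y' in nhds y. y' \<in> ball y (1/8)"
        by (rule eventually_nhds_in_open) auto
      then have "\<forall>\<^sub>F y' in nhds y. g (\<rho> y') = g (y' - (of_int (K1 y), of_int (K2 y)))"
        by (rule eventually_mono) (rule local)
      moreover have "isCont (\<lambda>y'. g (y' - (of_int (K1 y), of_int (K2 y)))) y"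
      proof (rule isCont_o2[where f="\<lambda>y'. y' - (of_int (K1 y), of_int (K2 y))" and g=g])
        show "isCont (\<lambda>y'. y' - (of_int (K1 y), of_int (K2 y))) y" by (intro continuous_intros)
        show "isCont g (y - (of_int (K1 y), of_int (K2 y)))"
          using g by (simp add: continuous_on_eq_continuous_at)
      qed
      ultimately show ?thesis
        by (simp add: isCont_cong[of "\<lambda>y. g (\<rho> y)"])
    qed
    then show "continuous_on UNIV (\<lambda>y. g (\<rho> y))"
      by (simp add: continuous_on_eq_continuous_at)
  next
    show "periodic2 (\<lambda>y. f (\<rho> y))" "periodic2 (\<lambda>y. g (\<rho> y))"
      by (auto intro!: periodic2I simp only: \<rho>_per)
  qed
  moreover have "g (\<rho> (y + (of_int k1, of_int k2))) = g y" if "dist y x < 1/4" for y and k1 k2 :: int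
  proof -
    have "\<bar>fst y - fst x\<bar> < 1/4" "\<bar>snd y - snd x\<bar> < 1/4"
      using that dist_fst_le[of y x] dist_snd_le[of y x] by (auto simp: dist_real_def)
    then have "K1 y = 0" "K2 y = 0" unfolding K1_def K2_def by linarith+
    then show ?thesis unfolding \<rho>_per by (simp add: \<rho>_def flip: zero_prod_def)
  qed
  moreover have "\<exists>(k1::int) (k2::int). g (\<rho> y) = g (y - (of_int k1, of_int k2))" for y
    unfolding \<rho>_def by blast
  ultimately show ?thesis by (rule that)
qed

section \<open>Explicit C^1 cut-offs of one variable\<close>

definition bump :: "real \<Rightarrow> real \<Rightarrow> real" where
  "bump \<epsilon> s = (max 0 (\<epsilon>\<^sup>2 - s\<^sup>2))\<^sup>2"

definition bump' :: "real \<Rightarrow> real \<Rightarrow> real" where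
  "bump' \<epsilon> s = 2 * max 0 (\<epsilon>\<^sup>2 - s\<^sup>2) * (- 2 * s)"

lemma bump_deriv: "(bump \<epsilon> has_field_derivative bump' \<epsilon> s) (at s)"
  unfolding bump_def bump'_def
  by (rule DERIV_chain2[OF pos_part_square_deriv]) (auto intro!: derivative_eq_intros)

lemma bump'_continuous: "continuous_on UNIV (bump' \<epsilon>)"
  unfolding bump'_def by (intro continuous_intros)

lemma bump_pos: "\<bar>s\<bar> < \<epsilon> \<Longrightarrow> bump \<epsilon> s > 0"
  using power_strict_mono[of "\<bar>s\<bar>" \<epsilon> 2] by (simp add: bump_def max_def)

lemma bump_zero: "\<epsilon> > 0 \<Longrightarrow> \<bar>s\<bar> \<ge> \<epsilon> \<Longrightarrow> bump \<epsilon> s = 0 \<and> bump' \<epsilon> s = 0"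
  using power_mono[of \<epsilon> "\<bar>s\<bar>" 2] by (simp add: bump_def bump'_def max_def)

text \<open>A second difference of the squared positive part. Its derivative is the tent 2 max(0,
  \<epsilon> - \<bar>s\<bar>), so the function climbs from 0 to 2 \<epsilon>^2 across the interval
  from - \<epsilon> to \<epsilon>.\<close>

definition step :: "real \<Rightarrow> real \<Rightarrow> real" where
  "step \<epsilon> s = (max 0 (s + \<epsilon>))\<^sup>2 - 2 * (max 0 s)\<^sup>2 + (max 0 (s - \<epsilon>))\<^sup>2"

definition step' :: "real \<Rightarrow> real \<Rightarrow> real" where
  "step' \<epsilon> s = 2 * max 0 (s + \<epsilon>) * 1 - 2 * (2 * max 0 s) + 2 * max 0 (s - \<epsilon>) * 1"

lemma step_deriv: "(step \<epsilon> has_field_derivative step' \<epsilon> s) (at s)"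
  unfolding step_def step'_def
  by (intro DERIV_add DERIV_diff DERIV_cmult pos_part_square_deriv DERIV_chain2[OF pos_part_square_deriv])
     (auto intro!: derivative_eq_intros)

lemma step'_continuous: "continuous_on UNIV (step' \<epsilon>)"
  unfolding step'_def by (intro continuous_intros)

lemma step'_pos: "\<bar>s\<bar> < \<epsilon> \<Longrightarrow> step' \<epsilon> s > 0"
  by (auto simp: step'_def max_def)

lemma step'_zero: "\<epsilon> > 0 \<Longrightarrow> \<bar>s\<bar> \<ge> \<epsilon> \<Longrightarrow> step' \<epsilon> s = 0"
  by (auto simp: step'_def max_def)

lemma step_left: "\<epsilon> > 0 \<Longrightarrow> s \<le> - \<epsilon> \<Longrightarrow> step \<epsilon> s = 0"
  by (auto simp: step_def max_def)

lemma step_right: "\<epsilon> > 0 \<Longrightarrow> s \<ge> \<epsilon> \<Longrightarrow> step \<epsilon> s = 2 * \<epsilon>\<^sup>2"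
  by (auto simp: step_def max_def power2_eq_square algebra_simps)

section \<open>Lifted balls and coordinates near a level line\<close>

text \<open>The periodic neighbourhood occurring in \<open>torus_support\<close>. Taking all
  translates lets a ball wrap around the edges of the cell that carries the measure.\<close>

definition torus_ball :: "real \<times> real \<Rightarrow> real \<Rightarrow> (real \<times> real) set" where
  "torus_ball y e = {z. \<exists>(k1::int) (k2::int). dist z (y + (of_int k1, of_int k2)) < e}"

lemma open_torus_ball: "open (torus_ball y e)"
proof -
  have "torus_ball y e = (\<Union>(k1::int) (k2::int). ball (y + (of_int k1, of_int k2)) e)"
    unfolding torus_ball_def ball_def by (intro set_eqI) (simp add: dist_commute)
  then show ?thesis by (simp add: open_UN)
qed

text \<open>The clockwise quarter turn. It undoes the rotation used for the gradient of the stream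
  function and so recovers the field tangent to the level lines.\<close>

definition rot :: "real \<times> real \<Rightarrow> real \<times> real" where
  "rot v = (snd v, - fst v)"

text \<open>Pythagoras in the orthogonal frame \<open>p\<close>, \<open>rot p\<close>, whose two
  vectors have equal length.\<close>

lemma norm_le_inner_rot: "norm p * norm v \<le> \<bar>p \<bullet> v\<bar> + \<bar>rot p \<bullet> v\<bar>" for p v :: "real \<times> real"
proof -
  have "(norm p * norm v)\<^sup>2 = (p \<bullet> v)\<^sup>2 + (rot p \<bullet> v)\<^sup>2"
    by (simp add: rot_def norm_prod_def inner_prod_def power_mult_distrib) (simp add: power2_eq_square algebra_simps)
  then have "norm p * norm v = sqrt ((p \<bullet> v)\<^sup>2 + (rot p \<bullet> v)\<^sup>2)"
    by (metis real_sqrt_unique norm_ge_zero mult_nonneg_nonneg)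
  then show ?thesis using sqrt_sum_squares_le_sum_abs by simp
qed

text \<open>A quantitative substitute for the inverse function theorem. Where the gradient stays
  within half of \<bar>g x\<bar> of \<open>g x\<close>, the deviation of \<open>u\<close> from its
  linear part is Lipschitz with that constant; absorbing it into the left-hand side costs the factor
  2.\<close>

lemma local_coordinates:
  fixes u :: "real \<times> real \<Rightarrow> real"
  assumes u: "\<And>y. (u has_derivative (\<lambda>h. g y \<bullet> h)) (at y)" and g: "continuous_on UNIV g"
    and "g x \<noteq> 0" "e > 0"
  obtains \<rho> where "\<rho> > 0" "\<rho> \<le> e" "\<And>y. y \<in> ball x \<rho> \<Longrightarrow> g x \<bullet> g y > 0"
    "\<And>y z. y \<in> ball x \<rho> \<Longrightarrow> z \<in> ball x \<rho> \<Longrightarrow>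
      norm (g x) * norm (y - z) \<le> 2 * \<bar>u y - u z\<bar> + 2 * \<bar>rot (g x) \<bullet> (y - z)\<bar>"
proof -
  let ?p = "g x"
  have p: "norm ?p > 0" using assms by simp
  have "\<exists>d>0. \<forall>y. dist y x < d \<longrightarrow> dist (g y) ?p < norm ?p / 2"
    using g[unfolded continuous_on_iff, rule_format, of x "norm ?p / 2"] p by auto
  then obtain d where d: "d > 0" "\<And>y. dist y x < d \<Longrightarrow> norm (g y - ?p) < norm ?p / 2"
    by (auto simp: dist_norm)
  define \<rho> where "\<rho> = min d e"
  have near: "norm (g y - ?p) < norm ?p / 2" if "y \<in> ball x \<rho>" for y
    using that d(2)[of y] by (simp add: \<rho>_def dist_commute)
  have pos: "?p \<bullet> g y > 0" if "y \<in> ball x \<rho>" for y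
  proof -
    have "\<bar>?p \<bullet> (g y - ?p)\<bar> \<le> norm ?p * norm (g y - ?p)"
      by (rule Cauchy_Schwarz_ineq2)
    also have "\<dots> < norm ?p * norm ?p"
    proof (rule mult_strict_left_mono[OF _ p])
      show "norm (g y - ?p) < norm ?p" using near[OF that] p by linarith
    qed
    finally show ?thesis by (auto simp: inner_diff_right power2_norm_eq_inner[symmetric] power2_eq_square)
  qed
  have "norm ?p * norm (y - z) \<le> 2 * \<bar>u y - u z\<bar> + 2 * \<bar>rot ?p \<bullet> (y - z)\<bar>"
    if "y \<in> ball x \<rho>" "z \<in> ball x \<rho>" for y z
  proof -
    have "norm ((u y - ?p \<bullet> y) - (u z - ?p \<bullet> z)) \<le> norm ?p / 2 * norm (y - z)"
    proof (rule differentiable_bound[of "ball x \<rho>" _ "\<lambda>y h. (g y - ?p) \<bullet> h"])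
      show "((\<lambda>y. u y - ?p \<bullet> y) has_derivative (\<lambda>h. (g w - ?p) \<bullet> h)) (at w within ball x \<rho>)" for w
        by (rule has_derivative_at_withinI, rule derivative_eq_intros u refl)+
           (auto simp: inner_diff_left)
      show "onorm (\<lambda>h. (g w - ?p) \<bullet> h) \<le> norm ?p / 2" if "w \<in> ball x \<rho>" for w
      proof (rule onorm_le)
        fix h
        show "norm ((g w - ?p) \<bullet> h) \<le> norm ?p / 2 * norm h"
          using Cauchy_Schwarz_ineq2[of "g w - ?p" h] mult_right_mono[OF less_imp_le[OF near[OF that]], of "norm h"]
          by simp
      qed
    qed (use that in auto)
    then have "\<bar>(u y - ?p \<bullet> y) - (u z - ?p \<bullet> z)\<bar> \<le> norm ?p * norm (y - z) / 2"
      by simp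
    then have "\<bar>?p \<bullet> (y - z)\<bar> \<le> \<bar>u y - u z\<bar> + norm ?p * norm (y - z) / 2"
      unfolding inner_diff_right by linarith
    then show ?thesis using norm_le_inner_rot[of ?p "y - z"] by simp
  qed
  then show ?thesis using d(1) \<open>e > 0\<close> pos by (intro that[of \<rho>]) (auto simp: \<rho>_def)
qed

text \<open>In the local coordinates \<open>u\<close> and \<open>w = rot (g x) \<bullet> (\<cdot> - x)\<close>, test with a product \<open>A (u) B (w)\<close> where \<open>A\<close> is a
  bump at \<open>u x\<close> and \<open>B'\<close> is a bump at \<open>w x\<close> minus a bump at \<open>w z\<close>: the mass near \<open>x\<close> is controlled by the mass near \<open>z\<close>.\<close>
lemma null_along_level_line:
  fixes u a \<sigma> :: "real \<times> real \<Rightarrow> real" and \<Phi> g :: "real \<times> real \<Rightarrow> real \<times> real"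
  assumes \<mu>: "prob_space \<mu>" "sets \<mu> = sets borel"
    and u: "\<And>y. (u has_derivative (\<lambda>h. g y \<bullet> h)) (at y)" and g: "continuous_on UNIV g"
    and \<sigma>\<Phi>: "\<And>y. \<sigma> y *\<^sub>R \<Phi> y = rot (g y)" and \<sigma>: "\<And>y. \<sigma> y > 0"
    and \<Phi>: "continuous_on UNIV \<Phi>" "periodic2 \<Phi>" and a: "continuous_on UNIV a" "periodic2 a"
    and div: "\<And>\<psi> h. C1_per \<psi> h \<Longrightarrow> (\<integral>y. max 0 (a y) * (h y \<bullet> \<Phi> y) \<partial>\<mu>) = 0"
    and gx: "g x \<noteq> 0"
  obtains r where "r > 0" "\<And>z e. dist z x < r \<Longrightarrow> u z = u x \<Longrightarrow> e > 0 \<Longrightarrow>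
      emeasure \<mu> ({y. a y > 0} \<inter> torus_ball z e) = 0 \<Longrightarrow>
      \<exists>e'>0. emeasure \<mu> ({y. a y > 0} \<inter> torus_ball x e') = 0"
proof -
  interpret prob_space \<mu> by fact
  have meas: "S \<in> sets \<mu>" if "open S" for S using that \<mu>(2) by auto
  have open_a: "open {y. a y > 0}" by (intro open_Collect_less a continuous_intros)
  let ?p = "g x"
  have p: "norm ?p > 0" using gx by simp
  \<comment> \<open>The radius bound 1/4 makes the test functions built in this ball fit into
    \<open>periodization\<close>.\<close>
  have quarter_pos: "(1/4 :: real) > 0" by simp
  obtain \<rho> where \<rho>: "\<rho> > 0" "\<rho> \<le> 1/4" "\<And>y. y \<in> ball x \<rho> \<Longrightarrow> ?p \<bullet> g y > 0"
    "\<And>y z. y \<in> ball x \<rho> \<Longrightarrow> z \<in> ball x \<rho> \<Longrightarrow>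
      norm ?p * norm (y - z) \<le> 2 * \<bar>u y - u z\<bar> + 2 * \<bar>rot ?p \<bullet> (y - z)\<bar>"
    by (rule local_coordinates[OF u g gx quarter_pos]) (rule that; blast)
  define w where "w y = rot ?p \<bullet> (y - x)" for y
  have w_diff: "rot ?p \<bullet> (y - z) = w y - w z" for y z
    by (simp only: w_def inner_diff_right)
  have coord: "norm ?p * norm (y - z) \<le> 2 * \<bar>u y - u z\<bar> + 2 * \<bar>w y - w z\<bar>"
    if "y \<in> ball x \<rho>" "z \<in> ball x \<rho>" for y z
    using \<rho>(4)[OF that] unfolding w_diff .
  have u_cont: "continuous_on UNIV u"
    by (rule has_derivative_continuous_on[OF has_derivative_at_withinI[OF u]])
  have w_cont: "continuous_on UNIV w"
    unfolding w_def by (intro continuous_intros)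
  have w_x: "w x = 0" by (simp add: w_def)
  have norm_rot: "norm (rot ?p) = norm ?p" by (simp add: rot_def norm_prod_def add.commute)
  have "\<exists>e'>0. emeasure \<mu> ({y. a y > 0} \<inter> torus_ball x e') = 0"
    if z: "dist z x < \<rho> / 16" "u z = u x" and "e > 0"
      and null: "emeasure \<mu> ({y. a y > 0} \<inter> torus_ball z e) = 0" for z e
  proof -
    have z_in: "z \<in> ball x \<rho>" using z(1) \<rho>(1) by (simp add: dist_commute)
    have wz: "\<bar>w z\<bar> \<le> norm ?p * \<rho> / 16"
    proof -
      have "\<bar>w z\<bar> \<le> norm ?p * norm (z - x)"
        using Cauchy_Schwarz_ineq2[of "rot ?p" "z - x"] by (simp only: w_def norm_rot)
      also have "\<dots> \<le> norm ?p * (\<rho> / 16)"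
        using z(1) p by (intro mult_left_mono) (auto simp: dist_norm)
      finally show ?thesis by simp
    qed
    \<comment> \<open>The first bound, together with \<open>wz\<close>, keeps the support of the
      test function within distance \<rho> / 2 of \<open>x\<close>: 4 \<epsilon> + 2 \<bar>w z\<bar>
      is at most 6/16 of norm ?p times \<rho>. The second puts the coordinate box of size \<epsilon>
      around \<open>z\<close> inside the ball of radius \<open>e\<close>.\<close>
    define \<epsilon> where "\<epsilon> = min (norm ?p * \<rho> / 16) (norm ?p * e / 8)"
    have \<epsilon>: "\<epsilon> > 0" "\<epsilon> \<le> norm ?p * \<rho> / 16" "\<epsilon> \<le> norm ?p * e / 8"
      unfolding \<epsilon>_def using mult_pos_pos[OF p \<rho>(1)] mult_pos_pos[OF p \<open>e > 0\<close>] by linarith+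
    note A = bump_deriv[of \<epsilon>] bump'_continuous[of \<epsilon>] bump_pos[of _ \<epsilon>] bump_zero[OF \<epsilon>(1)]
      and P = step_deriv[of \<epsilon>] step'_continuous[of \<epsilon>] step'_pos[of _ \<epsilon>] step'_zero[OF \<epsilon>(1)]
        step_left[OF \<epsilon>(1)] step_right[OF \<epsilon>(1)]
    \<comment> \<open>Both steps reach the same height, so they cancel far out and \<open>B\<close>
      has compact support, although its derivative is a positive tent at 0 minus one at
      \<open>w z\<close>. The tents may overlap; the signs below are only examined off the null set
      \<open>Z\<close>.\<close>
    define B where "B s = step \<epsilon> s - step \<epsilon> (s - w z)" for s
    define B' where "B' s = step' \<epsilon> s - step' \<epsilon> (s - w z)" for s
    have B: "(B has_field_derivative B' s) (at s)" for s
    proof -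
      have "((\<lambda>s. s - w z) has_field_derivative 1) (at s)"
        by (auto intro!: derivative_eq_intros)
      from DERIV_diff[OF P(1) DERIV_chain2[OF P(1) this]] show ?thesis
        by (simp add: B_def[abs_def] B'_def)
    qed
    have B'_cont: "continuous_on UNIV B'"
      unfolding B'_def by (intro continuous_intros P continuous_on_compose2[OF P(2)]) auto
    have B_zero: "B s = 0 \<and> B' s = 0" if "\<bar>s\<bar> \<ge> \<epsilon> + \<bar>w z\<bar>" for s
    proof (cases "s \<ge> 0")
      case True
      then show ?thesis using that \<epsilon>(1) P(4,6) by (simp add: B_def B'_def)
    next
      case False
      then show ?thesis using that \<epsilon>(1) P(4,5) by (simp add: B_def B'_def)
    qed
    \<comment> \<open>The formula is cut off outside the ball, since the level of \<open>u\<close>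
      and the strip in \<open>w\<close> may meet again far away. By \<open>vanish\<close> the
      product is already zero on the outer annulus, so the cut creates no jump.\<close>
    define f where "f y = (if y \<in> ball x \<rho> then bump \<epsilon> (u y - u x) * B (w y) else 0)" for y
    define h where "h y = (if y \<in> ball x \<rho> then (B (w y) * bump' \<epsilon> (u y - u x)) *\<^sub>R g y
      + (bump \<epsilon> (u y - u x) * B' (w y)) *\<^sub>R rot ?p else 0)" for y
    have vanish: "(bump \<epsilon> (u y - u x) = 0 \<and> bump' \<epsilon> (u y - u x) = 0) \<or> (B (w y) = 0 \<and> B' (w y) = 0)"
      if "y \<in> ball x \<rho>" "dist y x \<ge> \<rho> / 2" for y
    proof (rule ccontr)
      assume "\<not> ?thesis"
      then have "\<bar>u y - u x\<bar> < \<epsilon>" "\<bar>w y\<bar> < \<epsilon> + \<bar>w z\<bar>"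
        using A(4)[of "u y - u x"] B_zero[of "w y"] by linarith+
      then have "norm ?p * norm (y - x) < 2 * \<epsilon> + 2 * (\<epsilon> + \<bar>w z\<bar>)"
        using coord[OF that(1), of x] \<rho>(1) by (simp add: w_x)
      also have "\<dots> \<le> norm ?p * (\<rho> / 2)"
        using wz \<epsilon>(2) by simp
      finally show False using p that(2) by (simp add: dist_norm)
    qed
    have out: "f y = 0 \<and> h y = 0" if "dist y x \<ge> \<rho> / 2" for y
      using vanish[OF _ that] by (auto simp: f_def h_def)
    have open_out: "open (- cball x (\<rho> / 2))" by auto
    have cover: "y \<in> ball x \<rho> \<or> y \<in> - cball x (\<rho> / 2)" for y
      using \<rho>(1) by (auto simp: dist_commute)
    have f: "(f has_derivative (\<lambda>v. h y \<bullet> v)) (at y)" for y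
      using cover[of y]
    proof
      assume y: "y \<in> ball x \<rho>"
      have Au: "((\<lambda>y. bump \<epsilon> (u y - u x)) has_derivative (\<lambda>v. bump' \<epsilon> (u y - u x) * (g y \<bullet> v))) (at y)"
        by (rule has_derivative_compose[OF _ A(1)[unfolded has_field_derivative_def], of "\<lambda>y. u y - u x"])
           (auto intro!: derivative_eq_intros u)
      have Bw: "((\<lambda>y. B (w y)) has_derivative (\<lambda>v. B' (w y) * (rot ?p \<bullet> v))) (at y)"
      proof (rule has_derivative_compose[OF _ B[unfolded has_field_derivative_def], of w])
        show "(w has_derivative (\<lambda>v. rot ?p \<bullet> v)) (at y)"
          unfolding w_def by (rule derivative_eq_intros refl)+ simp
      qed
      have "((\<lambda>y. bump \<epsilon> (u y - u x) * B (w y)) has_derivative (\<lambda>v. h y \<bullet> v)) (at y)"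
        by (rule has_derivative_eq_rhs[OF has_derivative_mult[OF Au Bw]])
           (use y in \<open>simp add: h_def fun_eq_iff inner_add_left algebra_simps\<close>)
      then show ?thesis
        by (rule has_derivative_transform_within_open[OF _ open_ball y]) (auto simp: f_def)
    next
      assume y: "y \<in> - cball x (\<rho> / 2)"
      have "((\<lambda>y. 0) has_derivative (\<lambda>v. h y \<bullet> v)) (at y)"
        using out[of y] y by (simp add: dist_commute)
      then show ?thesis
        by (rule has_derivative_transform_within_open[OF _ open_out y])
           (use out in \<open>auto simp: dist_commute\<close>)
    qed
    have h: "continuous_on UNIV h"
    proof -
      have "continuous_on (ball x \<rho>) h"
      proof -
        have "continuous_on UNIV (\<lambda>y. (B (w y) * bump' \<epsilon> (u y - u x)) *\<^sub>R g y
              + (bump \<epsilon> (u y - u x) * B' (w y)) *\<^sub>R rot ?p)"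
          by (intro continuous_intros g continuous_on_compose2[OF A(2)]
              continuous_on_compose2[OF DERIV_continuous_on[OF has_field_derivative_at_within[OF A(1)]]]
              continuous_on_compose2[OF DERIV_continuous_on[OF has_field_derivative_at_within[OF B]]]
              continuous_on_compose2[OF B'_cont] u_cont w_cont) auto
        then show ?thesis
          by (rule continuous_on_eq[OF continuous_on_subset]) (auto simp: h_def)
      qed
      moreover have "continuous_on (- cball x (\<rho> / 2)) h"
        by (rule continuous_on_eq[OF continuous_on_const[of _ 0]]) (use out in \<open>auto simp: dist_commute\<close>)
      ultimately have "continuous_on (ball x \<rho> \<union> - cball x (\<rho> / 2)) h"
        by (rule continuous_on_open_Un[OF open_ball open_out])
      moreover have "ball x \<rho> \<union> - cball x (\<rho> / 2) = UNIV" using cover by blast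
      ultimately show ?thesis by simp
    qed
    have "f y = 0 \<and> h y = 0" if "dist y x > 1/4" for y
      using that \<rho>(1,2) by (intro out) simp
    from periodization[OF f h this]
    obtain F G where F: "C1_per F G"
      and G_near: "\<And>y (k1::int) (k2::int). dist y x < 1/4 \<Longrightarrow> G (y + (of_int k1, of_int k2)) = h y"
      and G_eq: "\<And>y. \<exists>(k1::int) (k2::int). G y = h (y - (of_int k1, of_int k2))"
      by blast
    \<comment> \<open>The term with the derivative of the bump in \<open>u\<close> drops out because
      \<open>g y\<close> is orthogonal to \<open>rot (g y)\<close>; the rest uses that
      \<open>rot\<close> preserves inner products.\<close>
    have h_\<Phi>: "\<sigma> y * (h y \<bullet> \<Phi> y) = bump \<epsilon> (u y - u x) * B' (w y) * (?p \<bullet> g y)" if "y \<in> ball x \<rho>" for y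
    proof -
      have "\<sigma> y * (h y \<bullet> \<Phi> y) = h y \<bullet> rot (g y)"
        by (simp add: \<sigma>\<Phi>[symmetric])
      also have "\<dots> = bump \<epsilon> (u y - u x) * B' (w y) * (?p \<bullet> g y)"
        using that by (simp add: h_def rot_def inner_prod_def algebra_simps)
      finally show ?thesis .
    qed
    define I where "I y = max 0 (a y) * (G y \<bullet> \<Phi> y)" for y
    have I_int: "integrable \<mu> I"
    proof -
      have c: "continuous_on UNIV I"
        unfolding I_def by (intro continuous_intros a \<Phi> C1_perD(2)[OF F])
      have "periodic2 I"
        using a(2) \<Phi>(2) C1_perD(4)[OF F] unfolding I_def by (auto intro!: periodic2I simp only: periodic2D)
      then obtain M where "\<And>x. norm (I x) \<le> M" using periodic2_bounded[OF c] by blast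
      then show ?thesis by (intro integrable_continuous_bounded[OF \<mu> c, of M]) simp
    qed
    define Z where "Z = {y. a y > 0} \<inter> torus_ball z e"
    have Z: "Z \<in> null_sets \<mu>"
      unfolding Z_def by (rule null_setsI[OF null meas[OF open_Int[OF open_a open_torus_ball]]])
    have in_Z: "y + (of_int k1, of_int k2) \<in> Z"
      if "y \<in> ball x \<rho>" "\<bar>u y - u x\<bar> < \<epsilon>" "\<bar>w y - w z\<bar> < \<epsilon>" "a y > 0" for y and k1 k2 :: int
    proof -
      have "norm ?p * norm (y - z) < 2 * \<epsilon> + 2 * \<epsilon>"
        using coord[OF that(1) z_in] that(2,3) by (simp add: z(2))
      also have "\<dots> < norm ?p * e"
        using \<epsilon>(3) mult_pos_pos[OF p \<open>e > 0\<close>] by simp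
      finally have "dist y z < e" using p by (simp add: dist_norm)
      then have "dist (y + (of_int k1, of_int k2)) (z + (of_int k1, of_int k2)) < e"
        by (simp add: dist_norm)
      then have "y + (of_int k1, of_int k2) \<in> torus_ball z e"
        unfolding torus_ball_def by blast
      then show ?thesis using that(4) periodic2D[OF a(2)] by (simp add: Z_def)
    qed
    \<comment> \<open>A negative value needs the negative tent of \<open>B'\<close>, a point with
      \<open>u\<close> close to u x = u z, and positive \<open>a\<close>. These together place the
      point in \<open>Z\<close>. Since the integral of \<open>I\<close> is 0, nonnegativity forces
      \<open>I\<close> to vanish almost everywhere.\<close>
    have "AE y in \<mu>. 0 \<le> I y"
    proof (rule AE_I'[OF Z], rule subsetI, rule ccontr)
      fix y assume "y \<in> {y \<in> space \<mu>. \<not> 0 \<le> I y}" and "y \<notin> Z"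
      then have neg: "I y < 0" by auto
      obtain k1 k2 :: int where k: "G y = h (y - (of_int k1, of_int k2))" using G_eq by blast
      define y' where "y' = y - (of_int k1, of_int k2)"
      have y: "y = y' + (of_int k1, of_int k2)" by (simp add: y'_def)
      have "max 0 (a y') * (h y' \<bullet> \<Phi> y') < 0"
        using neg periodic2_diffD[OF a(2), of y k1 k2] periodic2_diffD[OF \<Phi>(2), of y k1 k2]
        by (simp add: I_def k y'_def)
      then have a': "a y' > 0" and "h y' \<bullet> \<Phi> y' < 0"
        by (auto simp: max_def mult_less_0_iff split: if_splits)
      then have "\<sigma> y' * (h y' \<bullet> \<Phi> y') < 0"
        using \<sigma> by (simp add: mult_less_0_iff)
      moreover have y'_in: "y' \<in> ball x \<rho>"
        using \<open>h y' \<bullet> \<Phi> y' < 0\<close> by (auto simp: h_def split: if_splits)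
      ultimately have AB: "bump \<epsilon> (u y' - u x) * B' (w y') < 0"
        using h_\<Phi>[OF y'_in] \<rho>(3)[OF y'_in] by (simp add: mult_less_0_iff)
      have "\<bar>u y' - u x\<bar> < \<epsilon>"
        using AB A(4)[of "u y' - u x"] by fastforce
      moreover from this have "B' (w y') < 0"
        using AB A(3)[of "u y' - u x"] by (simp add: mult_less_0_iff)
      then have "\<bar>w y' - w z\<bar> < \<epsilon>"
        using P(3)[of "w y'"] P(4)[of "w y'"] P(4)[of "w y' - w z"] unfolding B'_def by linarith
      ultimately show False
        using in_Z[OF y'_in _ _ a', of k1 k2] \<open>y \<notin> Z\<close> y by simp
    qed
    then have "AE y in \<mu>. I y = 0"
      using integral_nonneg_eq_0_iff_AE[OF I_int] div[OF F] by (simp add: I_def[abs_def])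
    then have I0: "AE y in \<mu>. I y = 0 \<and> y \<notin> Z"
      using AE_not_in[OF Z] by simp
    have "open (ball x \<rho> \<inter> {y. \<bar>u y - u x\<bar> < \<epsilon>} \<inter> {y. \<bar>w y\<bar> < \<epsilon>})"
      by (intro open_Int open_ball open_Collect_less continuous_intros u_cont w_cont)
    then obtain e' where e': "e' > 0"
      "ball x e' \<subseteq> ball x \<rho> \<inter> {y. \<bar>u y - u x\<bar> < \<epsilon>} \<inter> {y. \<bar>w y\<bar> < \<epsilon>}"
      using open_contains_ball_eq[of _ x] \<rho>(1) \<epsilon>(1) w_x by (metis (mono_tags, lifting) IntI centre_in_ball mem_Collect_eq abs_zero diff_self)
    have "emeasure \<mu> ({y. a y > 0} \<inter> torus_ball x e') = 0"
    proof -
      \<comment> \<open>Close to \<open>x\<close> the positive tent is active, and off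
        \<open>Z\<close> the negative one is switched off, so \<open>I\<close> is strictly positive
        wherever \<open>a\<close> is. Such points can therefore only form a null set.\<close>
      have "\<not> (I y = 0 \<and> y \<notin> Z)" if y: "a y > 0" "y \<in> torus_ball x e'" for y
      proof
        assume asm: "I y = 0 \<and> y \<notin> Z"
        obtain k1 k2 :: int where k: "dist y (x + (of_int k1, of_int k2)) < e'"
          using y(2) by (auto simp: torus_ball_def)
        define y' where "y' = y - (of_int k1, of_int k2)"
        have yy: "y = y' + (of_int k1, of_int k2)" by (simp add: y'_def)
        have "y' \<in> ball x e'"
          using k by (simp add: y'_def dist_norm norm_minus_commute algebra_simps)
        then have y': "y' \<in> ball x \<rho>" "\<bar>u y' - u x\<bar> < \<epsilon>" "\<bar>w y'\<bar> < \<epsilon>"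
          using e'(2) by auto
        have a': "a y' > 0" using y(1) periodic2D[OF a(2), of y' k1 k2] yy by simp
        have "\<not> \<bar>w y' - w z\<bar> < \<epsilon>"
          using in_Z[OF y'(1,2) _ a', of k1 k2] asm yy by auto
        then have "B' (w y') > 0"
          using P(3)[OF y'(3)] P(4)[of "w y' - w z"] by (simp add: B'_def)
        then have "\<sigma> y' * (h y' \<bullet> \<Phi> y') > 0"
          unfolding h_\<Phi>[OF y'(1)] using A(3)[OF y'(2)] \<rho>(3)[OF y'(1)] by simp
        then have "h y' \<bullet> \<Phi> y' > 0" using \<sigma>[of y'] by (simp add: zero_less_mult_iff)
        moreover have "G y = h y'"
          unfolding yy using y'(1) \<rho>(2) by (intro G_near) (simp add: dist_commute)
        moreover have "\<Phi> y = \<Phi> y'" unfolding yy by (rule periodic2D[OF \<Phi>(2)])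
        ultimately show False using asm y(1) by (simp add: I_def)
      qed
      then have "y \<notin> {y. a y > 0} \<inter> torus_ball x e'" if "I y = 0 \<and> y \<notin> Z" for y
        using that by blast
      then have "AE y in \<mu>. y \<notin> {y. a y > 0} \<inter> torus_ball x e'"
        by (rule eventually_mono[OF I0])
      then show ?thesis
        using AE_iff_null_sets[OF meas[OF open_Int[OF open_a open_torus_ball[of x e']]]]
        by (simp add: null_setsD1)
    qed
    then show ?thesis using e'(1) by blast
  qed
  then show ?thesis using \<rho>(1) by (intro that[of "\<rho> / 16"]) auto
qed

section \<open>From local comparison to a global null set\<close>

lemma torus_ball_shift: "torus_ball (y + (of_int k1, of_int k2)) e = torus_ball y e"
proof -
  have shift: "z \<in> torus_ball (y + (of_int k1, of_int k2)) e" if "z \<in> torus_ball y e" for z y and k1 k2 :: int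
  proof -
    obtain l1 l2 :: int where "dist z (y + (of_int l1, of_int l2)) < e"
      using \<open>z \<in> torus_ball y e\<close> unfolding torus_ball_def by blast
    moreover have "y + (of_int l1, of_int l2) =
        y + (of_int k1, of_int k2) + (of_int (l1 - k1), of_int (l2 - k2))"
      by (simp add: prod_eq_iff)
    ultimately show ?thesis unfolding torus_ball_def by (metis (mono_tags, lifting) mem_Collect_eq)
  qed
  have cancel: "y + (of_int k1, of_int k2) + (of_int (- k1), of_int (- k2)) = y"
    by (simp add: prod_eq_iff)
  show ?thesis
    using shift[of _ y k1 k2] shift[of _ "y + (of_int k1, of_int k2)" "- k1" "- k2"] unfolding cancel
    by blast
qed

lemma torus_ball_subset:
  assumes "dist y y' < e - e'"
  shows "torus_ball y' e' \<subseteq> torus_ball y e"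
proof
  fix z assume "z \<in> torus_ball y' e'"
  then obtain k1 k2 :: int where k: "dist z (y' + (of_int k1, of_int k2)) < e'"
    by (auto simp: torus_ball_def)
  have "dist (y + (of_int k1, of_int k2)) (y' + (of_int k1, of_int k2)) = dist y y'"
    by (simp add: dist_norm)
  then have "dist z (y + (of_int k1, of_int k2)) < e"
    using k assms dist_triangle[of z "y + (of_int k1, of_int k2)" "y' + (of_int k1, of_int k2)"]
    by (simp add: dist_commute)
  then show "z \<in> torus_ball y e" unfolding torus_ball_def by blast
qed

lemma torus_ball_induct:
  assumes "\<And>z. z \<in> ball y e \<Longrightarrow> Q (a z)" "periodic2 a" "z \<in> torus_ball y e"
  shows "Q (a z)"
proof -
  obtain k1 k2 :: int where "dist z (y + (of_int k1, of_int k2)) < e"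
    using assms(3) unfolding torus_ball_def by blast
  then have "z - (of_int k1, of_int k2) \<in> ball y e"
    by (simp add: dist_norm norm_minus_commute algebra_simps)
  from assms(1)[OF this] show ?thesis by (simp add: periodic2_diffD[OF assms(2)])
qed

text \<open>A small step along the gradient raises \<open>u\<close>, and connectedness of the ball
  fills in the values between. A dense set of levels must therefore meet every ball.\<close>

lemma gradient_increasing_values:
  fixes u :: "'a::real_inner \<Rightarrow> real"
  assumes u: "\<And>y. (u has_derivative (\<lambda>h. g y \<bullet> h)) (at y)" and "g y \<noteq> 0" "e > 0"
  obtains \<delta> where "\<delta> > 0" "{u y..u y + \<delta>} \<subseteq> u ` ball y e"
proof -
  have "((\<lambda>t. y + t *\<^sub>R g y) has_derivative (\<lambda>t. t *\<^sub>R g y)) (at 0)"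
    by (auto intro!: derivative_eq_intros)
  from has_derivative_compose[OF this u]
  have "((\<lambda>t. u (y + t *\<^sub>R g y)) has_field_derivative g y \<bullet> g y) (at 0)"
    by (simp add: has_field_derivative_def mult_commute_abs)
  from DERIV_pos_inc_right[OF this] \<open>g y \<noteq> 0\<close>
  obtain d where d: "d > 0" "\<And>h. 0 < h \<Longrightarrow> h < d \<Longrightarrow> u y < u (y + h *\<^sub>R g y)"
    by auto
  define t where "t = min (d / 2) (e / (2 * norm (g y)))"
  have t: "0 < t" "t < d" "t \<le> e / (2 * norm (g y))"
    using d(1) assms by (auto simp: t_def)
  define z where "z = y + t *\<^sub>R g y"
  have "t * norm (g y) \<le> e / (2 * norm (g y)) * norm (g y)"
    using t(3) by (intro mult_right_mono) auto
  then have z: "z \<in> ball y e" "u y < u z"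
    using d(2)[OF t(1,2)] t(1) assms by (auto simp: z_def dist_norm)
  have "connected (u ` ball y e)"
    by (intro connected_continuous_image has_derivative_continuous_on[OF has_derivative_at_withinI[OF u]])
       (simp add: convex_connected)
  then have "{u y..u z} \<subseteq> u ` ball y e"
    using z \<open>e > 0\<close> by (intro connected_contains_Icc) auto
  then show ?thesis using z(2) by (intro that[of "u z - u y"]) auto
qed

text \<open>Stated for abstract \<open>u\<close>, \<open>g\<close>, \<open>c\<close>,
  \<open>\<Phi>\<close> and \<open>a\<close> so that it can be applied a second time with all their
  signs reversed.\<close>

lemma positive_part_null:
  fixes u a \<sigma> :: "real \<times> real \<Rightarrow> real" and \<Phi> g :: "real \<times> real \<Rightarrow> real \<times> real"
  assumes \<mu>: "prob_space \<mu>" "sets \<mu> = sets borel" "emeasure \<mu> (UNIV - ({0..<1} \<times> {0..<1})) = 0"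
    and u: "\<And>y. (u has_derivative (\<lambda>h. g y \<bullet> h)) (at y)"
    and g_lip: "\<And>y z. norm (g y - g z) \<le> L * norm (y - z)"
    and g0: "\<And>y. g y \<noteq> 0" and g_cont: "continuous_on UNIV g" and g_per: "periodic2 g"
    and u_shift: "\<And>y (k1::int) (k2::int). u (y + (of_int k1, of_int k2)) = u y + c k1 k2"
    and dense: "\<And>\<alpha> e. e > 0 \<Longrightarrow> \<exists>k1 k2. \<bar>c k1 k2 - \<alpha>\<bar> < e"
    and \<sigma>\<Phi>: "\<And>y. \<sigma> y *\<^sub>R \<Phi> y = rot (g y)" and \<sigma>: "\<And>y. \<sigma> y > 0"
    and \<Phi>: "continuous_on UNIV \<Phi>" "periodic2 \<Phi>" and a: "continuous_on UNIV a" "periodic2 a"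
    and div: "\<And>\<psi> h. C1_per \<psi> h \<Longrightarrow> (\<integral>y. max 0 (a y) * (h y \<bullet> \<Phi> y) \<partial>\<mu>) = 0"
    and neg: "a y\<^sub>0 < 0"
  shows "emeasure \<mu> {y. a y > 0} = 0"
proof -
  interpret prob_space \<mu> by fact
  have open_a: "open {y. a y > 0}" by (intro open_Collect_less a continuous_intros)
  have meas: "{y. a y > 0} \<inter> torus_ball y e \<in> sets \<mu>" for y e
    using open_Int[OF open_a open_torus_ball] \<mu>(2) by auto
  define S where "S = {y. \<forall>e>0. emeasure \<mu> ({y. a y > 0} \<inter> torus_ball y e) \<noteq> 0}"
  have "continuous_on UNIV (\<lambda>y. 1 / norm (g y))"
    using g0 by (intro continuous_intros g_cont) auto
  \<comment> \<open>Periodicity turns absence of critical points into a uniform lower bound for the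
    gradient, as the Newton steps require.\<close>
  moreover have "periodic2 (\<lambda>y. 1 / norm (g y))"
    using g_per by (auto intro!: periodic2I simp only: periodic2D)
  ultimately obtain M where M: "M > 0" "\<And>y. norm (1 / norm (g y)) \<le> M"
    using periodic2_bounded by blast
  have g_ge: "1 / M \<le> norm (g y)" for y
    using M(2)[of y] M(1) g0[of y] by (simp add: field_simps)
  have connected: "connected {y. u y = s}" for s
  proof -
    have "((\<lambda>y. u y - s) has_derivative (\<lambda>h. g y \<bullet> h)) (at y)" for y
      by (auto intro!: derivative_eq_intros u)
    from connected_level_set[OF this g_lip _ g_ge] M(1) show ?thesis by simp
  qed
  have S_closed: "closed S"
  proof -
    have "\<exists>d>0. ball y d \<subseteq> - S" if "y \<in> - S" for y
    proof -
      obtain e where e: "e > 0" "emeasure \<mu> ({y. a y > 0} \<inter> torus_ball y e) = 0"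
        using \<open>y \<in> - S\<close> unfolding S_def by blast
      have "y' \<in> - S" if "y' \<in> ball y (e / 2)" for y'
      proof -
        have "torus_ball y' (e / 2) \<subseteq> torus_ball y e"
          using that by (intro torus_ball_subset) auto
        then have "emeasure \<mu> ({y. a y > 0} \<inter> torus_ball y' (e / 2)) = 0"
          using emeasure_mono[OF Int_mono[OF subset_refl] meas] e(2) by (metis le_zero_eq)
        then show ?thesis using half_gt_zero[OF e(1)] unfolding S_def by blast
      qed
      then show ?thesis using e(1) by (intro exI[of _ "e / 2"]) auto
    qed
    then show ?thesis by (simp add: closed_def open_contains_ball)
  qed
  have S_level: "z \<in> S" if "x \<in> S" "u z = u x" for x z
  proof -
    let ?L = "{y. u y = u x}"
    \<comment> \<open>The local lemma is used in contrapositive form, centred at a point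
      \<open>y\<close> of \<open>S\<close>: a neighbour on the same level with a null ball would
      give \<open>y\<close> a null ball too.\<close>
    have "\<exists>r>0. ball y r \<inter> ?L \<subseteq> S \<inter> ?L" if "y \<in> S \<inter> ?L" for y
    proof -
      obtain r where r: "r > 0" and *: "\<And>z e. dist z y < r \<Longrightarrow> u z = u y \<Longrightarrow> e > 0 \<Longrightarrow>
        emeasure \<mu> ({y. a y > 0} \<inter> torus_ball z e) = 0 \<Longrightarrow>
        \<exists>e'>0. emeasure \<mu> ({y. a y > 0} \<inter> torus_ball y e') = 0"
      proof (rule null_along_level_line[of \<mu> u g \<sigma> \<Phi> a y])
        show "(\<integral>y. max 0 (a y) * (h y \<bullet> \<Phi> y) \<partial>\<mu>) = 0" if "C1_per \<psi> h" for \<psi> h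
          by (rule div[OF that])
      qed (rule \<mu> u g_cont \<sigma>\<Phi> \<sigma> \<Phi> a g0 that; blast)+
      have "z \<in> S" if "z \<in> ball y r" "u z = u x" for z
      proof -
        have "dist z y < r" "u z = u y" using that \<open>y \<in> S \<inter> ?L\<close> by (auto simp: dist_commute)
        from *[OF this] \<open>y \<in> S \<inter> ?L\<close> show ?thesis unfolding S_def by blast
      qed
      then show ?thesis using r by blast
    qed
    then have "openin (top_of_set ?L) (S \<inter> ?L)"
      by (auto simp: openin_contains_ball)
    moreover have "closedin (top_of_set ?L) (S \<inter> ?L)"
      using S_closed by (auto simp: closedin_closed)
    ultimately have "S \<inter> ?L = ?L"
      using connected[of "u x"] that(1) unfolding connected_clopen by blast
    then show ?thesis using that(2) by blast
  qed
  have S_shift: "y + (of_int k1, of_int k2) \<in> S" if "y \<in> S" for y and k1 k2 :: int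
    using that by (simp add: S_def torus_ball_shift)
  have "S = {}"
  proof (rule ccontr)
    assume "S \<noteq> {}"
    then obtain x where x: "x \<in> S" by blast
    have "open {y. a y < 0}" by (intro open_Collect_less a continuous_intros)
    then obtain e where e: "e > 0" "ball y\<^sub>0 e \<subseteq> {y. a y < 0}"
      using neg open_contains_ball by blast
    obtain \<delta> where \<delta>: "\<delta> > 0" "{u y\<^sub>0..u y\<^sub>0 + \<delta>} \<subseteq> u ` ball y\<^sub>0 e"
      by (rule gradient_increasing_values[OF u g0 e(1)])
    \<comment> \<open>The target is the midpoint of the interval of values attained near
      \<open>y\<^sub>0\<close>, so an error below \<delta> / 2 leaves the shifted level inside it.
      That level is contained in \<open>S\<close>, yet meets the open set where \<open>a\<close> is
      negative.\<close>
    obtain k1 k2 where k: "\<bar>c k1 k2 - (u y\<^sub>0 - u x + \<delta> / 2)\<bar> < \<delta> / 2"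
      using dense[OF half_gt_zero[OF \<delta>(1)]] by blast
    then have "u x + c k1 k2 \<in> {u y\<^sub>0..u y\<^sub>0 + \<delta>}"
      unfolding atLeastAtMost_iff by linarith
    then obtain y where y: "y \<in> ball y\<^sub>0 e" "u y = u x + c k1 k2" using \<delta>(2) by (metis imageE subsetD)
    have "y \<in> S"
      by (rule S_level[OF S_shift[OF x, of k1 k2]]) (simp add: u_shift y(2))
    obtain e' where e': "e' > 0" "ball y e' \<subseteq> ball y\<^sub>0 e"
      using open_contains_ball[THEN iffD1, OF open_ball, rule_format, OF y(1)] by blast
    have "a z < 0" if "z \<in> torus_ball y e'" for z
      by (rule torus_ball_induct[OF _ a(2) that]) (use e e' in blast)
    then have "{y. a y > 0} \<inter> torus_ball y e' = {}" by fastforce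
    then have "emeasure \<mu> ({y. a y > 0} \<inter> torus_ball y e') = 0" by simp
    then show False using \<open>y \<in> S\<close> e'(1) unfolding S_def by blast
  qed
  then have "\<forall>y. \<exists>e>0. emeasure \<mu> ({y. a y > 0} \<inter> torus_ball y e) = 0"
    unfolding S_def by blast
  then obtain e where e: "\<And>y. e y > 0" "\<And>y. emeasure \<mu> ({y. a y > 0} \<inter> torus_ball y (e y)) = 0"
    by metis
  \<comment> \<open>Locally null becomes null: finitely many balls cover the closed cell, and
    \<open>\<mu>\<close> gives no mass to the outside of the half-open one.\<close>
  have "compact (cbox (0, 0) (1, 1) :: (real \<times> real) set)" by simp
  then obtain T where T: "finite T" "cbox (0, 0) (1, 1) \<subseteq> (\<Union>y\<in>T. ball y (e y))"
  proof (rule compactE_image[of _ UNIV "\<lambda>y. ball y (e y)"])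
    show "cbox (0, 0) (1, 1) \<subseteq> (\<Union>y\<in>UNIV. ball y (e y))" using e(1) by (auto intro: centre_in_ball[THEN iffD2])
  qed (use that in auto)
  have "{y. a y > 0} \<subseteq> (\<Union>y\<in>T. {y. a y > 0} \<inter> torus_ball y (e y)) \<union> (UNIV - ({0..<1} \<times> {0..<1}))"
  proof
    fix y assume y: "y \<in> {y. a y > 0}"
    show "y \<in> (\<Union>y\<in>T. {y. a y > 0} \<inter> torus_ball y (e y)) \<union> (UNIV - ({0..<1} \<times> {0..<1}))"
    proof (cases "y \<in> {0..<1} \<times> {0..<1}")
      case True
      then have "y \<in> cbox (0, 0) (1, 1)" by (auto simp: cbox_Pair_eq)
      then obtain z where z: "z \<in> T" "y \<in> ball z (e z)" using T(2) by blast
      have "dist y (z + (of_int 0, of_int 0)) < e z"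
        using z(2) by (simp add: dist_commute flip: zero_prod_def)
      then have "y \<in> torus_ball z (e z)" unfolding torus_ball_def by blast
      then show ?thesis using y z(1) by blast
    qed blast
  qed
  moreover have "(\<Union>y\<in>T. {y. a y > 0} \<inter> torus_ball y (e y)) \<union> (UNIV - ({0..<1} \<times> {0..<1})) \<in> null_sets \<mu>"
  proof (intro null_sets.Un null_sets.finite_UN T(1))
    show "{y. a y > 0} \<inter> torus_ball y (e y) \<in> null_sets \<mu>" for y
      by (rule null_setsI[OF e(2) meas])
    have "UNIV - ({0..<1} \<times> {0..<1}) \<in> sets (borel :: (real \<times> real) measure)"
      by (intro sets.Diff borel_Times) auto
    then show "UNIV - ({0..<1} \<times> {0..<1}) \<in> null_sets \<mu>"
      using \<mu>(2,3) by auto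
  qed
  moreover have "{y. a y > 0} \<in> sets \<mu>" using open_a \<mu>(2) by auto
  ultimately show ?thesis using null_sets_subset by blast
qed

section \<open>Verification of the hypotheses and conclusion\<close>

lemma divergence2_gradient:
  assumes "((\<lambda>x. fst (F x)) has_derivative (\<lambda>h. D1 \<bullet> h)) (at x)"
    and "((\<lambda>x. snd (F x)) has_derivative (\<lambda>h. D2 \<bullet> h)) (at x)"
  shows "divergence2 F x = fst D1 + snd D2"
  unfolding divergence2_def frechet_derivative_at[OF assms(1), symmetric]
    frechet_derivative_at[OF assms(2), symmetric]
  by (simp add: inner_prod_def)

theorem theorem2p1:
  fixes a \<sigma> :: "real \<times> real \<Rightarrow> real"
    and \<Phi> b :: "real \<times> real \<Rightarrow> real \<times> real"
    and X :: "real \<Rightarrow> real \<times> real \<Rightarrow> real \<times> real"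
  assumes a_C1: "Ck_per 1 a"
    and a_sign: "\<exists>x y. a x < 0 \<and> a y > 0"
    and Phi_C3: "Ck_per_vec 3 \<Phi>"
    and Phi_nz: "\<forall>x. \<Phi> x \<noteq> 0"
    and b_def: "b = (\<lambda>x. a x *\<^sub>R \<Phi> x)"
    and sigma_C3: "Ck_per 3 \<sigma>"
    and sigma_pos: "\<forall>x. \<sigma> x > 0"
    and sigma_mean: "mean2 \<sigma> = 1"
    and div_free: "\<forall>x. divergence2 (\<lambda>y. \<sigma> y *\<^sub>R \<Phi> y) x = 0"
    and incomm: "incommensurable (mean2 (\<lambda>y. \<sigma> y *\<^sub>R \<Phi> y))"
    and flow: "is_flow b X"
  shows "(\<forall>\<mu>. invariant_measure X \<mu> \<longrightarrow> torus_support \<mu> \<subseteq> {y. a y = 0})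
         \<and> C_set X b = {0}"
proof -
  obtain a' where a: "C1_per a a'"
    using Ck_per_gradient[of 0 a] a_C1 by (metis One_nat_def)
  obtain \<sigma>' where \<sigma>: "C1_per \<sigma> \<sigma>'"
    using Ck_per_gradient[of 2 \<sigma>] sigma_C3 by (metis Suc_numeral semiring_norm(5))
  obtain \<Phi>1' where \<Phi>1: "C1_per (\<lambda>x. fst (\<Phi> x)) \<Phi>1'"
    using Ck_per_gradient[of 2 "\<lambda>x. fst (\<Phi> x)"] Phi_C3
    unfolding Ck_per_vec_def by (metis Suc_numeral semiring_norm(5))
  obtain \<Phi>2' where \<Phi>2: "C1_per (\<lambda>x. snd (\<Phi> x)) \<Phi>2'"
    using Ck_per_gradient[of 2 "\<lambda>x. snd (\<Phi> x)"] Phi_C3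
    unfolding Ck_per_vec_def by (metis Suc_numeral semiring_norm(5))
  have a_cont: "continuous_on UNIV a" and a_per: "periodic2 a"
    using C1_per_continuous[OF a] C1_perD(3)[OF a] by auto
  have \<Phi>_cont: "continuous_on UNIV \<Phi>"
    by (rule C1_per_pair_continuous[OF \<Phi>1 \<Phi>2])
  have \<Phi>_per: "periodic2 \<Phi>"
    by (rule periodic2I) (simp add: prod_eq_iff periodic2D[OF C1_perD(3)[OF \<Phi>1]] periodic2D[OF C1_perD(3)[OF \<Phi>2]])
  define F where "F y = \<sigma> y *\<^sub>R \<Phi> y" for y
  obtain D1 where D1: "C1_per (\<lambda>x. fst (F x)) D1"
    using C1_per_mult[OF \<sigma> \<Phi>1] by (simp add: F_def)
  obtain D2 where D2: "C1_per (\<lambda>x. snd (F x)) D2"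
    using C1_per_mult[OF \<sigma> \<Phi>2] by (simp add: F_def)
  have div: "fst (D1 x) + snd (D2 x) = 0" for x
    using div_free divergence2_gradient[OF C1_perD(1)[OF D1] C1_perD(1)[OF D2], of x]
    by (simp add: F_def[abs_def])
  define g where "g x = (- snd (F x), fst (F x))" for x
  define c where "c k1 k2 = of_int k2 * fst (mean2 F) - of_int k1 * snd (mean2 F)" for k1 k2 :: int
  obtain u where u': "\<And>x. (u has_derivative (\<lambda>h. (- snd (F x), fst (F x)) \<bullet> h)) (at x)"
    and u_shift': "\<And>x (k1::int) (k2::int). u (x + (of_int k1, of_int k2))
      = u x + (of_int k2 * fst (mean2 F) - of_int k1 * snd (mean2 F))"
  proof (rule stream_function[OF D1 D2 div])
    fix u
    assume "\<And>x. (u has_derivative (\<lambda>h. (- snd (F x), fst (F x)) \<bullet> h)) (at x)"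
      and "\<And>x (k1::int) (k2::int). u (x + (of_int k1, of_int k2))
        = u x + (of_int k2 * fst (mean2 F) - of_int k1 * snd (mean2 F))"
    then show thesis by (rule that)
  qed
  have u: "(u has_derivative (\<lambda>h. g x \<bullet> h)) (at x)" for x
    unfolding g_def by (rule u')
  have u_shift: "u (x + (of_int k1, of_int k2)) = u x + c k1 k2" for x and k1 k2 :: int
    unfolding c_def by (rule u_shift')
  have "incommensurable (mean2 F)" using incomm by (simp add: F_def[abs_def])
  then have dense: "\<exists>k1 k2. \<bar>c k1 k2 - \<alpha>\<bar> < e" if "e > 0" for \<alpha> e
    unfolding c_def using incommensurable_dense that by metis
  have g_C1: "C1_per (\<lambda>x. fst (g x)) (\<lambda>x. - D2 x)" "C1_per (\<lambda>x. snd (g x)) D1"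
    using C1_per_minus[OF D2] D1 by (auto simp: g_def)
  obtain L where g_lip: "\<And>x y. norm (g x - g y) \<le> L * norm (x - y)"
    using C1_per_pair_lipschitz[OF g_C1] by blast
  have g_cont: "continuous_on UNIV g"
    by (rule C1_per_pair_continuous[OF g_C1])
  have g_per: "periodic2 g"
    by (rule periodic2I) (simp add: prod_eq_iff periodic2D[OF C1_perD(3)[OF g_C1(1)]] periodic2D[OF C1_perD(3)[OF g_C1(2)]])
  have g_rot: "\<sigma> y *\<^sub>R \<Phi> y = rot (g y)" for y
    by (simp add: rot_def g_def F_def prod_eq_iff)
  have g0: "g y \<noteq> 0" for y
  proof
    assume "g y = 0"
    then have "\<sigma> y *\<^sub>R \<Phi> y = 0" unfolding g_rot by (simp add: rot_def zero_prod_def)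
    then show False using sigma_pos Phi_nz by (metis less_irrefl scaleR_eq_0_iff)
  qed
  have b1: "C1_per (\<lambda>x. fst (b x)) (\<lambda>x. a x *\<^sub>R \<Phi>1' x + fst (\<Phi> x) *\<^sub>R a' x)"
    and b2: "C1_per (\<lambda>x. snd (b x)) (\<lambda>x. a x *\<^sub>R \<Phi>2' x + snd (\<Phi> x) *\<^sub>R a' x)"
    using C1_per_mult[OF a \<Phi>1] C1_per_mult[OF a \<Phi>2] by (simp_all add: b_def)
  obtain K where b_lip: "\<And>x y. norm (b x - b y) \<le> K * norm (x - y)"
  proof (rule C1_per_pair_lipschitz[OF b1 b2])
    fix K assume "\<And>x y. norm (b x - b y) \<le> K * norm (x - y)"
    then show thesis by (rule that)
  qed
  have b_cont: "continuous_on UNIV b"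
    by (rule C1_per_pair_continuous[OF b1 b2])
  have b_per: "periodic2 b"
    unfolding b_def by (rule periodic2I) (simp only: periodic2D[OF a_per] periodic2D[OF \<Phi>_per])
  have null: "emeasure \<mu> {y. a y \<noteq> 0} = 0" if inv: "invariant_measure X \<mu>" for \<mu>
  proof -
    note \<mu> = invariant_measureD[OF inv]
    have weak: "(\<integral>y. h y \<bullet> (a y *\<^sub>R \<Phi> y) \<partial>\<mu>) = 0" if "C1_per \<psi> h" for \<psi> h
      using invariant_measure_divergence[OF flow b_lip b_cont b_per inv that] by (simp add: b_def)
    obtain y1 y2 where y: "a y1 < 0" "a y2 > 0" using a_sign by blast
    have "emeasure \<mu> {y. a y > 0} = 0"
    proof (rule positive_part_null[of \<mu> u g L c \<sigma> \<Phi> a y1])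
      show "(\<integral>y. max 0 (a y) * (h y \<bullet> \<Phi> y) \<partial>\<mu>) = 0" if "C1_per \<psi> h" for \<psi> h
        by (rule divergence_pos_part[OF \<mu>(1,2) a \<Phi>_cont \<Phi>_per weak that])
    qed (rule \<mu>(1-3) u g_lip g0 g_cont g_per u_shift dense g_rot \<Phi>_cont \<Phi>_per a_cont a_per y
        sigma_pos[rule_format] | assumption)+
    \<comment> \<open>Changing the signs of \<open>a\<close> and \<open>\<Phi>\<close> together
      leaves their product, hence the weak equation, unchanged; \<open>u\<close>, \<open>g\<close>
      and \<open>c\<close> change sign as well so that \<sigma> \<Phi> is still the rotated
      gradient. The point \<open>y2\<close>, where \<open>a\<close> is positive, now supplies the
      negative value.\<close>
    moreover have "emeasure \<mu> {y. - a y > 0} = 0"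
    proof (rule positive_part_null[of \<mu> "\<lambda>x. - u x" "\<lambda>x. - g x" L "\<lambda>k1 k2. - c k1 k2" \<sigma>
          "\<lambda>x. - \<Phi> x" "\<lambda>x. - a x" y2])
      show "(\<integral>y. max 0 (- a y) * (h y \<bullet> - \<Phi> y) \<partial>\<mu>) = 0" if "C1_per \<psi> h" for \<psi> h
      proof (rule divergence_pos_part[OF \<mu>(1,2) C1_per_minus[OF a] _ _ _ that])
        show "continuous_on UNIV (\<lambda>x. - \<Phi> x)" by (intro continuous_intros \<Phi>_cont)
        show "periodic2 (\<lambda>x. - \<Phi> x)" by (rule periodic2I) (simp add: periodic2D[OF \<Phi>_per])
        show "(\<integral>y. h y \<bullet> ((- a y) *\<^sub>R - \<Phi> y) \<partial>\<mu>) = 0" if "C1_per \<psi> h" for \<psi> h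
          using weak[OF that] by simp
      qed
      show "((\<lambda>x. - u x) has_derivative (\<lambda>h. - g y \<bullet> h)) (at y)" for y
        using has_derivative_minus[OF u[of y]] by simp
      show "norm (- g y - - g z) \<le> L * norm (y - z)" for y z
        using g_lip[of y z] by (simp add: norm_minus_commute)
      show "\<exists>k1 k2. \<bar>- c k1 k2 - \<alpha>\<bar> < e" if e: "e > 0" for \<alpha> e
      proof -
        obtain k1 k2 where "\<bar>c k1 k2 - (- \<alpha>)\<bar> < e" using dense[OF e] by blast
        then have "\<bar>- c k1 k2 - \<alpha>\<bar> < e" by linarith
        then show ?thesis by blast
      qed
      show "\<sigma> y *\<^sub>R - \<Phi> y = rot (- g y)" for y
        using g_rot[of y] by (simp add: rot_def prod_eq_iff)
      show "periodic2 (\<lambda>x. - g x)" "periodic2 (\<lambda>x. - \<Phi> x)" "periodic2 (\<lambda>x. - a x)"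
        by (rule periodic2I, simp add: periodic2D[OF g_per] periodic2D[OF \<Phi>_per] periodic2D[OF a_per])+
      show "- u (y + (of_int k1, of_int k2)) = - u y + - c k1 k2" for y and k1 k2 :: int
        by (simp add: u_shift)
    qed (use g0 y in \<open>auto intro!: continuous_intros \<mu>(1-3) g_cont \<Phi>_cont a_cont sigma_pos[rule_format]\<close>)
    moreover have "{y. a y > 0} \<in> sets \<mu>" "{y. - a y > 0} \<in> sets \<mu>"
      unfolding \<mu>(2) by (intro borel_open open_Collect_less continuous_intros a_cont)+
    moreover have "{y. a y \<noteq> 0} = {y. a y > 0} \<union> {y. - a y > 0}" by auto
    ultimately show ?thesis
      using null_sets.Un[of "{y. a y > 0}" \<mu> "{y. - a y > 0}"] by (auto simp: null_sets_def)
  qed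
  have supp: "torus_support \<mu> \<subseteq> {y. a y = 0}" if inv: "invariant_measure X \<mu>" for \<mu>
  proof (rule subsetI, rule ccontr)
    fix y assume y: "y \<in> torus_support \<mu>" "y \<notin> {y. a y = 0}"
    have open_a: "open {y. a y \<noteq> 0}" by (intro open_Collect_neq a_cont continuous_intros)
    then obtain e where e: "e > 0" "ball y e \<subseteq> {y. a y \<noteq> 0}"
      using y(2) open_contains_ball[THEN iffD1, OF open_a, rule_format, of y] by auto
    have "a z \<noteq> 0" if "z \<in> torus_ball y e" for z
      by (rule torus_ball_induct[OF _ a_per that]) (use e in blast)
    then have "emeasure \<mu> (torus_ball y e) \<le> emeasure \<mu> {y. a y \<noteq> 0}"
      using open_a invariant_measureD(2)[OF inv] by (intro emeasure_mono) auto
    then have "emeasure \<mu> (torus_ball y e) = 0" using null[OF inv] by simp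
    moreover have "emeasure \<mu> (torus_ball y e) > 0"
      using y(1) e(1) unfolding torus_support_def torus_ball_def by blast
    ultimately show False by simp
  qed
  have int0: "(\<integral>y. b y \<partial>\<mu>) = 0" if inv: "invariant_measure X \<mu>" for \<mu>
  proof (rule integral_eq_zero_AE)
    have "{y. a y \<noteq> 0} \<in> sets \<mu>"
      unfolding invariant_measureD(2)[OF inv]
      by (intro borel_open open_Collect_neq a_cont continuous_on_const)
    then have "{y. a y \<noteq> 0} \<in> null_sets \<mu>"
      by (rule null_setsI[OF null[OF inv]])
    then show "AE y in \<mu>. b y = 0"
    proof (rule AE_I')
      show "{y \<in> space \<mu>. b y \<noteq> 0} \<subseteq> {y. a y \<noteq> 0}" by (simp add: b_def subset_eq)
    qed
  qed
  \<comment> \<open>This is what puts 0 into \<open>C_set\<close>. A sign change of \<open>a\<close>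
    yields a zero, hence an equilibrium of the flow; moved into the half-open cell, it carries an
    invariant Dirac measure.\<close>
  have "\<exists>\<mu>. invariant_measure X \<mu>"
  proof -
    obtain y1 y2 where y: "a y1 < 0" "a y2 > 0" using a_sign by blast
    have "connected (range a)" by (rule connected_continuous_image[OF a_cont connected_UNIV])
    then have "0 \<in> range a" by (rule connectedD_interval[of _ "a y1" "a y2"]) (use y in auto)
    then obtain y where "a y = 0" by (metis rangeE)
    obtain k1 k2 :: int where k: "y - (of_int k1, of_int k2) \<in> {0..<1} \<times> {0..<1}"
      by (rule unit_cell_representative)
    define z where "z = y - (of_int k1, of_int k2)"
    have "b z = 0" using \<open>a y = 0\<close> by (simp add: b_def z_def periodic2_diffD[OF a_per])
    have X_z: "X t z = z" for t
      by (rule flow_equilibrium[OF flow b_lip \<open>b z = 0\<close>])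
    have "invariant_measure X (return borel z)"
      unfolding invariant_measure_def torus_prob_def
    proof (intro conjI allI impI)
      show "prob_space (return borel z)" by (rule prob_space_return) simp
      have "UNIV - ({0..<1} \<times> {0..<1}) \<in> sets (borel :: (real \<times> real) measure)"
        by (intro sets.Diff borel_Times) auto
      from emeasure_return[OF this, of z]
      show "emeasure (return borel z) (UNIV - ({0..<1} \<times> {0..<1})) = 0"
        using k unfolding z_def by simp
      fix t and \<psi> :: "real \<times> real \<Rightarrow> real" assume \<psi>: "continuous_on UNIV \<psi> \<and> periodic2 \<psi>"
      have "continuous_on UNIV \<psi>" using \<psi> ..
      moreover have "continuous_on UNIV (\<lambda>y. \<psi> (X t y))"
        by (rule continuous_on_compose2[OF \<open>continuous_on UNIV \<psi>\<close> flow_continuous[OF flow b_lip]]) simp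
      ultimately show "(\<integral>y. \<psi> (X t y) \<partial>return borel z) = (\<integral>y. \<psi> y \<partial>return borel z)"
        by (simp add: integral_return borel_measurable_continuous_onI X_z)
    qed simp
    then show ?thesis by blast
  qed
  then have "0 \<in> C_set X b"
    unfolding C_set_def using int0 by fastforce
  moreover have "C_set X b \<subseteq> {0}"
    unfolding C_set_def using int0 by blast
  ultimately have "C_set X b = {0}" by blast
  with supp show ?thesis by blast
qed

end
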